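(* There is a randomized algorithm in the static multiple-access channel model (with collision detection) which, on an input simple graph with $m$ edges, finds a spanning forest $T$ in expected time $\mathcal{O}(|T|)$ and in worst-case time $\mathcal{O}(m)$.
   Context: Model: the input is a simple graph $G$ (no edge weights) on vertex set $\{1,\dots,n\}$ with $m$ edges. There are $m$ stations with distinct IDs $1,\dots,m$; each station holds exactly one edge of $G$, and every edge is held by exactly one station. All stations know $n$; they do not know $m$. Computation is synchronous with a global clock. In each step every station either broadcasts a message or not. If exactly one station broadcasts, its message is heard by all stations; if none broadcasts, all hear silence; if two or more broadcast, all hear a collision signal distinct from silence. All stations participate from the first step. An edge is revealed when it is heard on the channel. A spanning forest of $G$ is a maximal acyclic set of edges of $G$; the algorithm finds a spanning forest $T$ if all edges of $T$ are revealed during the execution before termination; $|T|$ is the number of edges of $T$. Time is the number of steps until termination. In a randomized algorithm, stations may additionally base their decisions on independent random coin flips. *)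

theory Defs
  imports "HOL-Probability.Probability"
begin

section \<open>Graphs and spanning forests\<close>

type_synonym edge = "nat set"

definition simple_graph :: "nat \<Rightarrow> edge set \<Rightarrow> bool" where
  "simple_graph n E \<longleftrightarrow> E \<subseteq> {{u, v} | u v. u \<in> {1..n} \<and> v \<in> {1..n} \<and> u \<noteq> v}"

text \<open>
  A cycle is given by its list of distinct vertices; the index is reduced modulo the length so that
  the closing edge from the last vertex back to the first is included.
\<close>

definition is_cycle :: "edge set \<Rightarrow> nat list \<Rightarrow> bool" where
  "is_cycle F vs \<longleftrightarrow> 3 \<le> length vs \<and> distinct vs \<and>
     (\<forall>i < length vs. {vs ! i, vs ! (Suc i mod length vs)} \<in> F)"

definition acyclic_edges :: "edge set \<Rightarrow> bool" where
  "acyclic_edges F \<longleftrightarrow> (\<nexists>vs. is_cycle F vs)"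

definition spanning_forest :: "edge set \<Rightarrow> edge set \<Rightarrow> bool" where
  "spanning_forest E T \<longleftrightarrow> T \<subseteq> E \<and> acyclic_edges T \<and>
     (\<forall>F. T \<subseteq> F \<and> F \<subseteq> E \<and> acyclic_edges F \<longrightarrow> F = T)"


section \<open>Multiple-access channel with collision detection\<close>

text \<open>
  A message consists of arbitrary control bits and, optionally, an edge. The edge component is not
  chosen by the algorithm: \<open>Broadcast True bits\<close> attaches the edge held by the broadcasting station
  (see \<open>transmission\<close> below), so that a station can only reveal the edge it holds.
\<close>

datatype message = Message "edge option" "bool list"

datatype feedback = Silence | Collision | Heard message

datatype action = Listen | Broadcast bool "bool list"

text \<open>
  All that a station knows: the number of vertices, its ID, its edge, and, for each past step, the
  outcomes of the coins that it flipped and what it heard. The number of stations is not included.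
\<close>

record view =
  num_vertices :: nat
  ident :: nat
  own_edge :: edge
  history :: "(bool list \<times> feedback) list"

text \<open>
  At the beginning of each step, every station that has not halted decides whether to halt. If it
  does not, it flips the finite number of coins prescribed by \<open>flips\<close> and acts on their outcome.
\<close>

record algorithm =
  halts :: "view \<Rightarrow> bool"
  flips :: "view \<Rightarrow> nat"
  act :: "view \<Rightarrow> bool list \<Rightarrow> action"

text \<open>
  \<open>\<omega> (i, t, k)\<close> is the outcome of the \<open>k\<close>-th coin of station \<open>i\<close> in step \<open>t\<close>; all coins are fair
  and independent. Steps are numbered from 0.
\<close>

type_synonym coins = "nat \<times> nat \<times> nat \<Rightarrow> bool"

definition coin_space :: "coins measure" where
  "coin_space = PiM UNIV (\<lambda>_. measure_pmf (bernoulli_pmf (1 / 2)))"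

text \<open>
  In the following, \<open>m\<close> is the number of stations, \<open>held i\<close> is the edge held by station \<open>i\<close>, and
  \<open>H i\<close> is the history of station \<open>i\<close> at the beginning of the current step.
\<close>

definition view_of ::
  "nat \<Rightarrow> (nat \<Rightarrow> edge) \<Rightarrow> (nat \<Rightarrow> (bool list \<times> feedback) list) \<Rightarrow> nat \<Rightarrow> view" where
  "view_of n held H i =
     \<lparr>num_vertices = n, ident = i, own_edge = held i, history = H i\<rparr>"

definition running ::
  "algorithm \<Rightarrow> nat \<Rightarrow> nat \<Rightarrow> (nat \<Rightarrow> edge) \<Rightarrow> (nat \<Rightarrow> (bool list \<times> feedback) list) \<Rightarrow> nat set" where
  "running A n m held H = {i \<in> {1..m}. \<not> halts A (view_of n held H i)}"

definition outcomes ::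
  "algorithm \<Rightarrow> nat \<Rightarrow> (nat \<Rightarrow> edge) \<Rightarrow> coins \<Rightarrow> nat \<Rightarrow> (nat \<Rightarrow> (bool list \<times> feedback) list)
     \<Rightarrow> nat \<Rightarrow> bool list" where
  "outcomes A n held \<omega> t H i = map (\<lambda>k. \<omega> (i, t, k)) [0..<flips A (view_of n held H i)]"

fun transmission :: "edge \<Rightarrow> action \<Rightarrow> message option" where
  "transmission e Listen = None"
| "transmission e (Broadcast reveal bits) = Some (Message (if reveal then Some e else None) bits)"

definition transmissions ::
  "algorithm \<Rightarrow> nat \<Rightarrow> nat \<Rightarrow> (nat \<Rightarrow> edge) \<Rightarrow> coins \<Rightarrow> nat
     \<Rightarrow> (nat \<Rightarrow> (bool list \<times> feedback) list) \<Rightarrow> nat \<Rightarrow> message option" where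
  "transmissions A n m held \<omega> t H i =
     (if i \<in> running A n m held H
      then transmission (held i) (act A (view_of n held H i) (outcomes A n held \<omega> t H i))
      else None)"

definition channel :: "(nat \<Rightarrow> message option) \<Rightarrow> feedback" where
  "channel s =
     (if \<forall>i. s i = None then Silence
      else if \<exists>!i. s i \<noteq> None then Heard (the (s (THE i. s i \<noteq> None)))
      else Collision)"

text \<open>
  The history of a station that has halted no longer changes; in particular, it remains halted.
\<close>

primrec histories ::
  "algorithm \<Rightarrow> nat \<Rightarrow> nat \<Rightarrow> (nat \<Rightarrow> edge) \<Rightarrow> coins \<Rightarrow> nat
     \<Rightarrow> nat \<Rightarrow> (bool list \<times> feedback) list" where
  "histories A n m held \<omega> 0 = (\<lambda>i. [])"
| "histories A n m held \<omega> (Suc t) =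
     (let H = histories A n m held \<omega> t;
          f = channel (transmissions A n m held \<omega> t H)
      in (\<lambda>i. if i \<in> running A n m held H then H i @ [(outcomes A n held \<omega> t H i, f)] else H i))"

definition heard_at ::
  "algorithm \<Rightarrow> nat \<Rightarrow> nat \<Rightarrow> (nat \<Rightarrow> edge) \<Rightarrow> coins \<Rightarrow> nat \<Rightarrow> feedback" where
  "heard_at A n m held \<omega> t =
     channel (transmissions A n m held \<omega> t (histories A n m held \<omega> t))"

definition terminated ::
  "algorithm \<Rightarrow> nat \<Rightarrow> nat \<Rightarrow> (nat \<Rightarrow> edge) \<Rightarrow> coins \<Rightarrow> nat \<Rightarrow> bool" where
  "terminated A n m held \<omega> t \<longleftrightarrow> running A n m held (histories A n m held \<omega> t) = {}"

text \<open>
  The number of steps until termination; it is \<open>\<infinity>\<close> (the infimum of the empty set) for an execution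
  that does not terminate.
\<close>

definition running_time ::
  "algorithm \<Rightarrow> nat \<Rightarrow> nat \<Rightarrow> (nat \<Rightarrow> edge) \<Rightarrow> coins \<Rightarrow> enat" where
  "running_time A n m held \<omega> = (INF t \<in> {t. terminated A n m held \<omega> t}. enat t)"

definition revealed ::
  "algorithm \<Rightarrow> nat \<Rightarrow> nat \<Rightarrow> (nat \<Rightarrow> edge) \<Rightarrow> coins \<Rightarrow> edge set" where
  "revealed A n m held \<omega> =
     {e. \<exists>t bits. enat t < running_time A n m held \<omega> \<and>
                  heard_at A n m held \<omega> t = Heard (Message (Some e) bits)}"

definition expected_time ::
  "algorithm \<Rightarrow> nat \<Rightarrow> nat \<Rightarrow> (nat \<Rightarrow> edge) \<Rightarrow> ennreal" where
  "expected_time A n m held =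
     (\<integral>\<^sup>+ \<omega>. ennreal_of_enat (running_time A n m held \<omega>) \<partial>coin_space)"


section \<open>The running time is a random variable\<close>

text \<open>
  Up to any given step only finitely many coins matter, so the running time of every algorithm is
  measurable and the integral in \<open>expected_time\<close> is its expectation.
\<close>

lemma space_coin_space: "space coin_space = UNIV"
  by (simp add: coin_space_def space_PiM)

lemma prob_space_coin_space: "prob_space coin_space"
  unfolding coin_space_def by (intro prob_space_PiM prob_space_measure_pmf)

lemma finite_range_of_finite_dependence:
  fixes h :: "('a \<Rightarrow> bool) \<Rightarrow> 'b"
  assumes "finite J" and dep: "\<And>\<omega> \<omega>'. (\<forall>j\<in>J. \<omega> j = \<omega>' j) \<Longrightarrow> h \<omega> = h \<omega>'"
  shows "finite (range h)"
proof -
  have "h \<omega> = h (restrict \<omega> J)" for \<omega>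
    by (rule dep) simp
  then have "range h \<subseteq> h ` (PiE J (\<lambda>_. UNIV))"
    by (intro image_subsetI) (auto intro!: image_eqI[of _ h "restrict _ J"])
  moreover have "finite (PiE J (\<lambda>_. UNIV :: bool set))"
    using \<open>finite J\<close> by (intro finite_PiE) auto
  ultimately show ?thesis
    by (meson finite_imageI finite_subset)
qed

lemma histories_finite_dependence:
  "\<exists>J. finite J \<and> (\<forall>\<omega> \<omega>'. (\<forall>j\<in>J. \<omega> j = \<omega>' j) \<longrightarrow>
     histories A n m held \<omega> t = histories A n m held \<omega>' t)"
proof (induction t)
  case 0
  show ?case by (intro exI[of _ "{}"]) simp
next
  case (Suc t)
  then obtain J where J: "finite J"
    and dep: "\<And>\<omega> \<omega>'. (\<forall>j\<in>J. \<omega> j = \<omega>' j) \<Longrightarrow>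
      histories A n m held \<omega> t = histories A n m held \<omega>' t"
    by blast
  let ?R = "range (\<lambda>\<omega>. histories A n m held \<omega> t)"
  have R: "finite ?R"
    using J dep by (rule finite_range_of_finite_dependence)
  let ?K = "\<Union>H\<in>?R. \<Union>i\<in>{1..m}. (\<lambda>k. (i, t, k)) ` {..<flips A (view_of n held H i)}"
  have "histories A n m held \<omega> (Suc t) = histories A n m held \<omega>' (Suc t)"
    if agree: "\<forall>j\<in>J \<union> ?K. \<omega> j = \<omega>' j" for \<omega> \<omega>'
  proof -
    define H where "H = histories A n m held \<omega> t"
    have H': "histories A n m held \<omega>' t = H"
      using dep[of \<omega> \<omega>'] agree by (auto simp: H_def)
    have out: "outcomes A n held \<omega> t H i = outcomes A n held \<omega>' t H i"
      if "i \<in> running A n m held H" for i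
    proof -
      have "i \<in> {1..m}" using that by (simp add: running_def)
      then have "(i, t, k) \<in> ?K" if "k < flips A (view_of n held H i)" for k
        using that unfolding H_def by blast
      then have "\<omega> (i, t, k) = \<omega>' (i, t, k)" if "k < flips A (view_of n held H i)" for k
        using that agree by blast
      then show ?thesis by (simp add: outcomes_def)
    qed
    have "transmissions A n m held \<omega> t H = transmissions A n m held \<omega>' t H"
      by (rule ext) (simp add: transmissions_def out)
    then show ?thesis
      by (intro ext) (simp add: H' H_def[symmetric] Let_def out)
  qed
  moreover have "finite (J \<union> ?K)"
    using J R by blast
  ultimately show ?case by blast
qed

lemma measurable_of_finite_dependence:
  fixes h :: "coins \<Rightarrow> 'b"
  assumes "finite J" and dep: "\<And>\<omega> \<omega>'. (\<forall>j\<in>J. \<omega> j = \<omega>' j) \<Longrightarrow> h \<omega> = h \<omega>'"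
  shows "h \<in> measurable coin_space (count_space UNIV)"
proof -
  let ?M = "PiM J (\<lambda>_. measure_pmf (bernoulli_pmf (1 / 2)))"
  have eq: "h \<omega> = h (restrict \<omega> J)" for \<omega>
    by (rule dep) simp
  have "sets ?M = sets (PiM J (\<lambda>_. count_space (UNIV :: bool set)))"
    by (intro sets_PiM_cong) auto
  also have "\<dots> = sets (count_space (PiE J (\<lambda>_. UNIV)))"
    using \<open>finite J\<close> by (subst count_space_PiM_finite) auto
  finally have "measurable ?M (count_space UNIV) =
      measurable (count_space (PiE J (\<lambda>_. UNIV))) (count_space (UNIV :: 'b set))"
    by (intro measurable_cong_sets) auto
  then have "h \<in> measurable ?M (count_space UNIV)"
    by simp
  moreover have "(\<lambda>\<omega>. restrict \<omega> J) \<in> measurable coin_space ?M"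
    unfolding coin_space_def by (rule measurable_restrict_subset) simp
  ultimately have "(\<lambda>\<omega>. h (restrict \<omega> J)) \<in> measurable coin_space (count_space UNIV)"
    by (rule measurable_compose_rev)
  then show ?thesis by (simp only: eq[symmetric])
qed

lemma measurable_running_time:
  "running_time A n m held \<in> measurable coin_space (count_space UNIV)"
proof -
  have "Measurable.pred coin_space (\<lambda>\<omega>. terminated A n m held \<omega> t)" for t
  proof -
    obtain J where "finite J"
      and J: "\<forall>\<omega> \<omega>'. (\<forall>j\<in>J. \<omega> j = \<omega>' j) \<longrightarrow>
        histories A n m held \<omega> t = histories A n m held \<omega>' t"
      using histories_finite_dependence[of A n m held t] by (elim exE conjE)
    show ?thesis
    proof (rule measurable_of_finite_dependence[OF \<open>finite J\<close>])
      fix \<omega> \<omega>' :: coins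
      assume "\<forall>j\<in>J. \<omega> j = \<omega>' j"
      then have "histories A n m held \<omega> t = histories A n m held \<omega>' t"
        using J by iprover
      then show "terminated A n m held \<omega> t = terminated A n m held \<omega>' t"
        unfolding terminated_def by (rule arg_cong)
    qed
  qed
  then have [measurable]:
    "\<And>t. (\<lambda>\<omega>. if terminated A n m held \<omega> t then enat t else \<infinity>) \<in>
       measurable coin_space (count_space UNIV)"
    by measurable
  have "running_time A n m held \<omega> =
      (INF t. if terminated A n m held \<omega> t then enat t else \<infinity>)" for \<omega>
    unfolding running_time_def
    by (intro antisym INF_greatest) (auto intro: INF_lower Inf_lower split: if_splits)
  then have "running_time A n m held =
      (\<lambda>\<omega>. INF t. if terminated A n m held \<omega> t then enat t else \<infinity>)"
    by (rule ext)
  then show ?thesis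
    by (rule ssubst) measurable
qed

end

theory Submission
  imports Defs
begin

text \<open>
  All stations know the forest revealed so far; a station is active if its edge extends this forest
  to a larger acyclic set. In odd steps every active station broadcasts its edge with probability
  \<open>2 ^ - k\<close>, where the common level \<open>k\<close> goes up after a collision and down after silence, so that it
  performs a random walk drifting towards the logarithm of the number \<open>N\<close> of active stations. Silence
  at level 0 proves that no station is active. In even steps the stations take turns, which forces
  termination in \<open>O(m)\<close> steps.

  For the expected time, consider \<open>a (R - |F|) + b max (3 log N - k) (log N + k)\<close>, where \<open>F\<close> is the
  revealed forest and \<open>R = 2 |T|\<close> bounds its size. A drop of \<open>N\<close> never increases the second term, a
  success pays for a wrong move of the level, and so the expected potential decreases by at least a
  constant per round. Since all edges lie on the at most \<open>2 |T|\<close> vertices of \<open>T\<close>, the initial value is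
  \<open>O(|T| + log m) = O(|T|)\<close>.
\<close>

section \<open>Acyclic edge sets\<close>

lemma acyclic_edges_subset: "acyclic_edges F \<Longrightarrow> F' \<subseteq> F \<Longrightarrow> acyclic_edges F'"
  unfolding acyclic_edges_def is_cycle_def by blast

lemma acyclic_edges_empty: "acyclic_edges {}"
  unfolding acyclic_edges_def is_cycle_def by fastforce

text \<open>An edge from position \<open>j\<close> of a path back to its start closes the prefix up
  to \<open>j\<close> into a cycle; \<open>2 \<le> j\<close> supplies the three vertices that
  \<open>is_cycle\<close> demands.\<close>

lemma is_cycle_take:
  assumes path: "\<And>i. Suc i < length vs \<Longrightarrow> {vs ! i, vs ! Suc i} \<in> F" and "distinct vs"
    and j: "2 \<le> j" "j < length vs" and close: "{vs ! j, vs ! 0} \<in> F"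
  shows "is_cycle F (take (Suc j) vs)"
proof -
  have "{take (Suc j) vs ! i, take (Suc j) vs ! (Suc i mod length (take (Suc j) vs))} \<in> F"
    if "i < length (take (Suc j) vs)" for i
  proof (cases "i = j")
    case True
    then show ?thesis using j close by simp
  next
    case False
    then have "i < j" using that by simp
    then show ?thesis using j path[of i] by simp
  qed
  then show ?thesis
    unfolding is_cycle_def using j \<open>distinct vs\<close> by auto
qed

text \<open>The first vertex of a longest path has degree one.\<close>

lemma acyclic_edges_degree_one:
  assumes pairs: "\<And>e. e \<in> F \<Longrightarrow> \<exists>u v. e = {u, v} \<and> u \<noteq> v" and "finite F" "F \<noteq> {}"
    and acyc: "acyclic_edges F"
  shows "\<exists>v e. v \<in> \<Union>F \<and> {e' \<in> F. v \<in> e'} = {e}"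
proof -
  define path where "path vs \<longleftrightarrow> 2 \<le> length vs \<and> distinct vs \<and> set vs \<subseteq> \<Union>F \<and>
    (\<forall>i. Suc i < length vs \<longrightarrow> {vs ! i, vs ! Suc i} \<in> F)" for vs
  have fin: "finite (\<Union>F)"
    using pairs \<open>finite F\<close> by (intro finite_Union) (auto dest: pairs)
  obtain u v where uv: "{u, v} \<in> F" "u \<noteq> v"
    using pairs \<open>F \<noteq> {}\<close> by blast
  have "path [u, v]"
    using uv by (auto simp: path_def)
  moreover have "length vs \<le> card (\<Union>F)" if "path vs" for vs
    using that card_mono[OF fin, of "set vs"] unfolding path_def by (metis distinct_card)
  ultimately obtain vs where vs: "path vs" and max: "\<And>ws. path ws \<Longrightarrow> length ws \<le> length vs"
    using ex_has_greatest_nat[of path "[u, v]" length "Suc (card (\<Union>F))"] by (metis le_imp_less_Suc)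
  have len: "2 \<le> length vs" and dist: "distinct vs" and sub: "set vs \<subseteq> \<Union>F"
    and edges: "\<And>i. Suc i < length vs \<Longrightarrow> {vs ! i, vs ! Suc i} \<in> F"
    using vs by (auto simp: path_def)
  \<comment> \<open>A second edge at the first vertex either ends on the path and closes a cycle, or
    ends off the path and prolongs it at the front.\<close>
  have only: "e = {vs ! 0, vs ! 1}" if e: "e \<in> F" "vs ! 0 \<in> e" for e
  proof (rule ccontr)
    assume ne: "e \<noteq> {vs ! 0, vs ! 1}"
    obtain w where w: "e = {w, vs ! 0}" "w \<noteq> vs ! 0"
      using pairs[OF e(1)] e(2) by (auto simp: insert_commute)
    show False
    proof (cases "w \<in> set vs")
      case True
      then obtain j where j: "j < length vs" "w = vs ! j"
        by (auto simp: in_set_conv_nth)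
      have "j \<noteq> 0" "j \<noteq> 1"
        using w ne j by (auto simp: insert_commute)
      then have "is_cycle F (take (Suc j) vs)"
        using j w e edges dist by (intro is_cycle_take) auto
      then show False
        using acyc by (auto simp: acyclic_edges_def)
    next
      case False
      have "w \<in> \<Union>F"
        using w e by blast
      moreover have "{(w # vs) ! i, (w # vs) ! Suc i} \<in> F" if "Suc i < length (w # vs)" for i
        using that w e edges by (cases i) auto
      ultimately have "path (w # vs)"
        using False len dist sub unfolding path_def by simp
      then show False
        using max[of "w # vs"] by simp
    qed
  qed
  have "{vs ! 0, vs ! 1} \<in> F"
    using edges[of 0] len by simp
  then have "{e' \<in> F. vs ! 0 \<in> e'} = {{vs ! 0, vs ! 1}}"
    by (intro equalityI subsetI) (simp_all add: only del: One_nat_def)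
  moreover have "vs ! 0 \<in> \<Union>F"
    using sub len by (metis nth_mem subsetD less_le_trans zero_less_numeral)
  ultimately show ?thesis by blast
qed

text \<open>Induction on the number of vertices: a vertex of degree one is deleted together with its
  only edge, which lowers both cardinalities by one.\<close>

lemma acyclic_edges_card_le:
  assumes "finite V" "acyclic_edges F" "finite F"
    and pairs: "\<And>e. e \<in> F \<Longrightarrow> \<exists>u v. e = {u, v} \<and> u \<noteq> v" and "\<Union>F \<subseteq> V"
  shows "card F \<le> card V"
  using assms
proof (induction "card V" arbitrary: V F)
  case 0
  then have "F = {}"
    by (metis UnionI all_not_in_conv card_0_eq insertCI subset_empty)
  then show ?case by simp
next
  case (Suc c)
  show ?case
  proof (cases "F = {}")
    case False
    obtain v e where v: "v \<in> \<Union>F" and e: "{e' \<in> F. v \<in> e'} = {e}"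
      using acyclic_edges_degree_one[OF Suc.prems(4) Suc.prems(3) False Suc.prems(2)] by blast
    have vV: "v \<in> V" using v Suc.prems(5) by blast
    have eF: "e \<in> F" using e by blast
    have "card (F - {e}) \<le> card (V - {v})"
    proof (rule Suc.hyps(1))
      show "c = card (V - {v})"
        using Suc.hyps(2) vV Suc.prems(1) by simp
      show "\<Union>(F - {e}) \<subseteq> V - {v}"
        using Suc.prems(5) e by blast
    qed (use Suc.prems acyclic_edges_subset[of F "F - {e}"] in auto)
    then show ?thesis
      using card.remove[OF Suc.prems(3) eF] card.remove[OF Suc.prems(1) vV] by simp
  qed simp
qed

section \<open>Size bounds in terms of a spanning forest\<close>

text \<open>A new cycle would have to use \<open>e\<close> and so pass through \<open>u\<close>.
  Both cycle edges at \<open>u\<close> would then be \<open>e\<close>, forcing the two neighbours of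
  \<open>u\<close> on the cycle to coincide.\<close>

lemma acyclic_edges_insert_pendant:
  assumes acyc: "acyclic_edges T" and u: "u \<notin> \<Union>T" "u \<in> e"
  shows "acyclic_edges (insert e T)"
  unfolding acyclic_edges_def
proof
  assume "\<exists>vs. is_cycle (insert e T) vs"
  then obtain vs where vs: "is_cycle (insert e T) vs" by blast
  define l where "l = length vs"
  have l: "3 \<le> l" and dist: "distinct vs"
    and cyc: "\<And>i. i < l \<Longrightarrow> {vs ! i, vs ! (Suc i mod l)} \<in> insert e T"
    using vs by (auto simp: is_cycle_def l_def)
  have "\<not> is_cycle T vs"
    using acyc by (auto simp: acyclic_edges_def)
  then obtain i where i: "i < l" "{vs ! i, vs ! (Suc i mod l)} \<notin> T"
    using l dist by (auto simp: is_cycle_def l_def)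
  then have "{vs ! i, vs ! (Suc i mod l)} = e"
    using cyc by blast
  then have "u = vs ! i \<or> u = vs ! (Suc i mod l)"
    using u by blast
  then obtain p where p: "p < l" "u = vs ! p"
    using i l by (metis mod_less_divisor less_le_trans zero_less_numeral)
  \<comment> \<open>The successor and the predecessor of \<open>p\<close> on the cycle; they differ
    because \<open>3 \<le> l\<close>.\<close>
  define s q where "s = Suc p mod l" and "q = (if p = 0 then l - 1 else p - 1)"
  have q: "q < l" "Suc q mod l = p"
    using p l by (auto simp: q_def)
  have s: "s < l" and "s \<noteq> q"
    using p l by (auto simp: s_def q_def mod_Suc split: if_splits)
  have "s \<noteq> p" "q \<noteq> p" using p l by (auto simp: s_def q_def mod_Suc split: if_splits)
  have "{u, vs ! s} = e" "{vs ! q, u} = e"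
    using cyc[of p] cyc[of q] p q u by (auto simp: s_def)
  then have "vs ! s = vs ! q"
    using dist p s q \<open>s \<noteq> p\<close> \<open>q \<noteq> p\<close> by (auto simp: doubleton_eq_iff)
  then show False
    using dist s q \<open>s \<noteq> q\<close> by (simp add: nth_eq_iff_index_eq l_def)
qed

text \<open>An edge with an endpoint untouched by \<open>T\<close> could be added to
  \<open>T\<close> as a pendant edge, against maximality.\<close>

lemma spanning_forest_vertices:
  assumes T: "spanning_forest E T"
  shows "\<Union>E = \<Union>T"
proof -
  have "u \<in> \<Union>T" if "e \<in> E" "u \<in> e" for e u
  proof (rule ccontr)
    assume u: "u \<notin> \<Union>T"
    have "acyclic_edges (insert e T)"
      using T u \<open>u \<in> e\<close> by (intro acyclic_edges_insert_pendant) (auto simp: spanning_forest_def)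
    then have "insert e T = T"
      using T \<open>e \<in> E\<close> by (auto simp: spanning_forest_def)
    then show False using u \<open>u \<in> e\<close> by blast
  qed
  then show ?thesis
    using T by (auto simp: spanning_forest_def)
qed

lemma simple_graph_edgeD:
  "simple_graph n E \<Longrightarrow> e \<in> E \<Longrightarrow> \<exists>u v. e = {u, v} \<and> u \<noteq> v"
  unfolding simple_graph_def by blast

lemma simple_graph_finite: "simple_graph n E \<Longrightarrow> finite E"
proof -
  assume "simple_graph n E"
  then have "E \<subseteq> Pow {1..n}" by (auto simp: simple_graph_def)
  then show "finite E" by (rule finite_subset) simp
qed

context
  fixes n E T
  assumes graph: "simple_graph n E" and T: "spanning_forest E T"
begin

lemma spanning_forest_vertices_finite: "finite (\<Union>E)"
  using simple_graph_finite[OF graph] by (intro finite_Union) (auto dest: simple_graph_edgeD[OF graph])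

lemma spanning_forest_card_vertices: "card (\<Union>E) \<le> 2 * card T"
proof -
  have TE: "T \<subseteq> E" using T by (simp add: spanning_forest_def)
  have "card (\<Union>T) \<le> (\<Sum>e\<in>T. card e)"
    by (rule card_Union_le_sum_card)
  also have "\<dots> = (\<Sum>e\<in>T. 2)"
    using TE by (intro sum.cong) (auto dest!: simple_graph_edgeD[OF graph, OF subsetD])
  finally show ?thesis
    by (simp add: spanning_forest_vertices[OF T])
qed

text \<open>An acyclic set has at most as many edges as there are vertices, and \<open>T\<close>
  covers all of these, two per edge. This caps the number of successes of the algorithm.\<close>

lemma spanning_forest_card_acyclic:
  assumes "F \<subseteq> E" "acyclic_edges F"
  shows "card F \<le> 2 * card T"
proof -
  have "card F \<le> card (\<Union>E)"
    using assms spanning_forest_vertices_finite finite_subset[OF assms(1) simple_graph_finite[OF graph]]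
    by (intro acyclic_edges_card_le simple_graph_edgeD[OF graph]) auto
  then show ?thesis
    using spanning_forest_card_vertices by simp
qed

text \<open>An edge is given by a pair of vertices covered by \<open>T\<close>. This makes the
  logarithm of the number of stations \<open>O(card T)\<close>.\<close>

lemma spanning_forest_card_edges: "card E \<le> (2 * card T)\<^sup>2"
proof -
  have "E \<subseteq> (\<lambda>(u, v). {u, v}) ` (\<Union>E \<times> \<Union>E)"
  proof
    fix e assume "e \<in> E"
    obtain u v where e: "e = {u, v}"
      using simple_graph_edgeD[OF graph \<open>e \<in> E\<close>] by (elim exE conjE)
    have "(u, v) \<in> \<Union>E \<times> \<Union>E"
      using \<open>e \<in> E\<close> unfolding e by blast
    then show "e \<in> (\<lambda>(u, v). {u, v}) ` (\<Union>E \<times> \<Union>E)"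
      unfolding e by (rule image_eqI[rotated]) simp
  qed
  then have "card E \<le> card (\<Union>E \<times> \<Union>E)"
    by (intro surj_card_le finite_cartesian_product spanning_forest_vertices_finite)
  also have "\<dots> \<le> (2 * card T)\<^sup>2"
    unfolding card_cartesian_product power2_eq_square
    using spanning_forest_card_vertices by (intro mult_le_mono)
  finally show ?thesis .
qed

end


section \<open>Independence of coins\<close>

text \<open>Tracks which coins a quantity reads: finite sets yield measurability, disjoint finite
  sets yield independence.\<close>

definition determined_by :: "(nat \<times> nat \<times> nat) set \<Rightarrow> (coins \<Rightarrow> 'b) \<Rightarrow> bool" where
  "determined_by J h \<longleftrightarrow> (\<forall>\<omega> \<omega>'. (\<forall>j\<in>J. \<omega> j = \<omega>' j) \<longrightarrow> h \<omega> = h \<omega>')"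

lemma determined_byD: "determined_by J h \<Longrightarrow> (\<And>j. j \<in> J \<Longrightarrow> \<omega> j = \<omega>' j) \<Longrightarrow> h \<omega> = h \<omega>'"
  unfolding determined_by_def by blast

lemma determined_by_mono: "determined_by J h \<Longrightarrow> J \<subseteq> J' \<Longrightarrow> determined_by J' h"
  unfolding determined_by_def subset_iff by blast

lemma determined_by_comp: "determined_by J h \<Longrightarrow> determined_by J (\<lambda>\<omega>. g (h \<omega>))"
  unfolding determined_by_def by metis

lemma determined_by_diagonal:
  assumes "\<And>\<omega>'. determined_by J (\<lambda>\<omega>. h \<omega> \<omega>')" "\<And>\<omega>. determined_by J' (h \<omega>)"
  shows "determined_by (J \<union> J') (\<lambda>\<omega>. h \<omega> \<omega>)"
  unfolding determined_by_def
proof (intro allI impI)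
  fix \<omega> \<omega>' :: coins
  assume eq: "\<forall>j\<in>J \<union> J'. \<omega> j = \<omega>' j"
  have "h \<omega> \<omega> = h \<omega>' \<omega>"
    using eq by (intro determined_byD[OF assms(1)]) auto
  also have "\<dots> = h \<omega>' \<omega>'"
    using eq by (intro determined_byD[OF assms(2)]) auto
  finally show "h \<omega> \<omega> = h \<omega>' \<omega>'" .
qed

lemma determined_by_measurable:
  "finite J \<Longrightarrow> determined_by J h \<Longrightarrow> h \<in> measurable coin_space (count_space UNIV)"
  unfolding determined_by_def by (rule measurable_of_finite_dependence) auto

lemma borel_measurable_determined_by:
  fixes h :: "coins \<Rightarrow> 'b :: topological_space"
  assumes "finite J" "determined_by J h"
  shows "h \<in> borel_measurable coin_space"
proof -
  have "(\<lambda>x. x) \<circ> h \<in> borel_measurable coin_space"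
    by (rule measurable_comp[OF determined_by_measurable[OF assms]]) simp
  then show ?thesis by (simp add: comp_def)
qed

abbreviation coin_product :: "(nat \<times> nat \<times> nat) set \<Rightarrow> coins measure" where
  "coin_product J \<equiv> PiM J (\<lambda>_. measure_pmf (bernoulli_pmf (1 / 2)))"

interpretation coin: product_prob_space "\<lambda>_ :: nat \<times> nat \<times> nat. measure_pmf (bernoulli_pmf (1 / 2))" UNIV
  by unfold_locales

text \<open>Over finitely many coins the product sigma-algebra contains every set of
  outcomes.\<close>

lemma borel_measurable_coin_product:
  fixes h :: "coins \<Rightarrow> 'b :: topological_space"
  assumes "finite J"
  shows "h \<in> borel_measurable (coin_product J)"
proof -
  have "sets (coin_product J) = sets (PiM J (\<lambda>_. count_space (UNIV :: bool set)))"
    by (intro sets_PiM_cong) auto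
  also have "\<dots> = sets (count_space (PiE J (\<lambda>_. UNIV)))"
    using \<open>finite J\<close> by (subst count_space_PiM_finite) auto
  finally have "measurable (coin_product J) borel =
      measurable (count_space (PiE J (\<lambda>_. UNIV))) (borel :: 'b measure)"
    by (intro measurable_cong_sets) auto
  then show ?thesis by simp
qed

text \<open>The marginal of the infinite product on \<open>J\<close> is the finite product, where
  Fubini is available.\<close>

lemma nn_integral_coin_space_determined:
  assumes "finite J" "determined_by J h"
  shows "(\<integral>\<^sup>+ \<omega>. h \<omega> \<partial>coin_space) = (\<integral>\<^sup>+ \<omega>. h \<omega> \<partial>coin_product J)"
proof -
  have "(\<integral>\<^sup>+ \<omega>. h \<omega> \<partial>coin_product J) =
      (\<integral>\<^sup>+ \<omega>. h \<omega> \<partial>distr (PiM UNIV (\<lambda>_. measure_pmf (bernoulli_pmf (1 / 2)))) (coin_product J) (\<lambda>\<omega>. restrict \<omega> J))"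
    by (simp add: coin.distr_PiM_restrict_finite[OF \<open>finite J\<close>])
  also have "\<dots> = (\<integral>\<^sup>+ \<omega>. h (restrict \<omega> J) \<partial>coin_space)"
    unfolding coin_space_def
    by (subst nn_integral_distr)
      (auto intro!: measurable_restrict_subset borel_measurable_coin_product[OF \<open>finite J\<close>])
  also have "\<dots> = (\<integral>\<^sup>+ \<omega>. h \<omega> \<partial>coin_space)"
    by (rule nn_integral_cong, rule determined_byD[OF assms(2)]) simp
  finally show ?thesis ..
qed

text \<open>The coins in \<open>J'\<close> may be flipped anew, because they are independent of those in \<open>J\<close>.\<close>

lemma nn_integral_coin_space_resample:
  fixes h :: "coins \<Rightarrow> coins \<Rightarrow> ennreal"
  assumes J: "finite J" "finite J'" "J \<inter> J' = {}"
    and 1: "\<And>\<omega>'. determined_by J (\<lambda>\<omega>. h \<omega> \<omega>')" and 2: "\<And>\<omega>. determined_by J' (h \<omega>)"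
  shows "(\<integral>\<^sup>+ \<omega>. h \<omega> \<omega> \<partial>coin_space) = (\<integral>\<^sup>+ \<omega>. \<integral>\<^sup>+ \<omega>'. h \<omega> \<omega>' \<partial>coin_space \<partial>coin_space)"
proof -
  \<comment> \<open>On merged coins the first argument of \<open>h\<close> sees only
    \<open>\<omega>\<close> and the second only \<open>\<omega>'\<close>, so the integral over
    \<open>J \<union> J'\<close> splits into an iterated one.\<close>
  have merge: "h (merge J J' (\<omega>, \<omega>')) (merge J J' (\<omega>, \<omega>')) = h \<omega> \<omega>'" for \<omega> \<omega>'
  proof -
    have "h (merge J J' (\<omega>, \<omega>')) (merge J J' (\<omega>, \<omega>')) = h \<omega> (merge J J' (\<omega>, \<omega>'))"
      by (rule determined_byD[OF 1]) (simp add: merge_def)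
    also have "\<dots> = h \<omega> \<omega>'"
      using J by (intro determined_byD[OF 2]) (auto simp: merge_def)
    finally show ?thesis .
  qed
  have "determined_by (J \<union> J') (\<lambda>\<omega>. h \<omega> \<omega>)"
    using 1 2 by (rule determined_by_diagonal)
  then have "(\<integral>\<^sup>+ \<omega>. h \<omega> \<omega> \<partial>coin_space) = (\<integral>\<^sup>+ \<omega>. h \<omega> \<omega> \<partial>coin_product (J \<union> J'))"
    using J by (intro nn_integral_coin_space_determined) auto
  also have "\<dots> = (\<integral>\<^sup>+ \<omega>. \<integral>\<^sup>+ \<omega>'. h (merge J J' (\<omega>, \<omega>')) (merge J J' (\<omega>, \<omega>'))
      \<partial>coin_product J' \<partial>coin_product J)"
    using J by (intro coin.product_nn_integral_fold borel_measurable_coin_product) auto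
  also have "\<dots> = (\<integral>\<^sup>+ \<omega>. \<integral>\<^sup>+ \<omega>'. h \<omega> \<omega>' \<partial>coin_product J' \<partial>coin_product J)"
    by (simp only: merge)
  also have "\<dots> =
      (\<integral>\<^sup>+ \<omega>. \<integral>\<^sup>+ \<omega>'. h \<omega> \<omega>' \<partial>coin_space \<partial>coin_product J)"
    using J 2 by (intro nn_integral_cong nn_integral_coin_space_determined[symmetric]) auto
  also have "\<dots> = (\<integral>\<^sup>+ \<omega>. \<integral>\<^sup>+ \<omega>'. h \<omega> \<omega>' \<partial>coin_space \<partial>coin_space)"
    using J 1 by (intro nn_integral_coin_space_determined[symmetric])
      (auto simp: determined_by_def intro!: nn_integral_cong)
  finally show ?thesis .
qed

section \<open>Probabilities of events read off finitely many coins\<close>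

interpretation coin_space: prob_space coin_space
  by (rule prob_space_coin_space)

abbreviation coin_prob :: "(coins \<Rightarrow> bool) \<Rightarrow> real" where
  "coin_prob Q \<equiv> measure coin_space {\<omega>. Q \<omega>}"

lemma sets_determined_by:
  assumes "finite J" "determined_by J Q"
  shows "{\<omega>. Q \<omega>} \<in> sets coin_space"
proof -
  have "Q -` {True} \<inter> space coin_space \<in> sets coin_space"
    by (rule measurable_sets[OF determined_by_measurable[OF assms]]) simp
  then show ?thesis by (simp add: space_coin_space vimage_def)
qed

lemma nn_integral_of_bool_coin_space:
  assumes "finite J" "determined_by J Q"
  shows "(\<integral>\<^sup>+ \<omega>. of_bool (Q \<omega>) \<partial>coin_space) = ennreal (coin_prob Q)"
proof -
  have "(\<integral>\<^sup>+ \<omega>. of_bool (Q \<omega>) \<partial>coin_space) = (\<integral>\<^sup>+ \<omega>. indicator {\<omega>. Q \<omega>} \<omega> \<partial>coin_space)"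
    by (intro nn_integral_cong) (simp add: indicator_def)
  then show ?thesis
    using sets_determined_by[OF assms] by (simp add: coin_space.emeasure_eq_measure)
qed

text \<open>Resampling turns the indicator of the conjunction into a product of indicators in
  separate variables, and the double integral factors.\<close>

lemma coin_prob_conj:
  assumes "finite J" "finite J'" "J \<inter> J' = {}" and Q: "determined_by J Q" and R: "determined_by J' R"
  shows "coin_prob (\<lambda>\<omega>. Q \<omega> \<and> R \<omega>) = coin_prob Q * coin_prob R"
proof -
  have "determined_by (J \<union> J') (\<lambda>\<omega>. Q \<omega> \<and> R \<omega>)"
    using Q R by (intro determined_by_diagonal) (auto simp: determined_by_def)
  then have "ennreal (coin_prob (\<lambda>\<omega>. Q \<omega> \<and> R \<omega>)) = (\<integral>\<^sup>+ \<omega>. of_bool (Q \<omega> \<and> R \<omega>) \<partial>coin_space)"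
    using assms by (intro nn_integral_of_bool_coin_space[symmetric]) auto
  also have "\<dots> = (\<integral>\<^sup>+ \<omega>. \<integral>\<^sup>+ \<omega>'. of_bool (Q \<omega> \<and> R \<omega>') \<partial>coin_space \<partial>coin_space)"
    using assms
    by (intro nn_integral_coin_space_resample[of J J'])
      (auto intro!: determined_by_comp[OF Q, of "\<lambda>b. of_bool (b \<and> _)"]
        determined_by_comp[OF R, of "\<lambda>b. of_bool (_ \<and> b)"])
  also have "\<dots> = (\<integral>\<^sup>+ \<omega>. \<integral>\<^sup>+ \<omega>'. of_bool (Q \<omega>) * of_bool (R \<omega>') \<partial>coin_space \<partial>coin_space)"
    by (simp add: of_bool_conj)
  also have "\<dots> = (\<integral>\<^sup>+ \<omega>. of_bool (Q \<omega>) * ennreal (coin_prob R) \<partial>coin_space)"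
    using assms
    by (simp add: nn_integral_cmult borel_measurable_determined_by[OF _ determined_by_comp[OF R]]
        nn_integral_of_bool_coin_space)
  also have "\<dots> = ennreal (coin_prob Q) * ennreal (coin_prob R)"
    using assms
    by (simp add: nn_integral_multc borel_measurable_determined_by[OF _ determined_by_comp[OF Q]]
        nn_integral_of_bool_coin_space)
  also have "\<dots> = ennreal (coin_prob Q * coin_prob R)"
    by (simp add: ennreal_mult)
  finally show ?thesis
    by (subst (asm) ennreal_inj) auto
qed

lemma coin_prob_not:
  assumes "finite J" "determined_by J Q"
  shows "coin_prob (\<lambda>\<omega>. \<not> Q \<omega>) = 1 - coin_prob Q"
proof -
  have "{\<omega>. \<not> Q \<omega>} = space coin_space - {\<omega>. Q \<omega>}"
    by (auto simp: space_coin_space)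
  then show ?thesis
    using coin_space.prob_compl[OF sets_determined_by[OF assms]] by simp
qed

lemma coin_space_prob_UNIV: "coin_space.prob UNIV = 1"
  using coin_space.prob_space by (simp add: space_coin_space)

lemma coin_prob_single: "coin_prob (\<lambda>\<omega>. \<omega> j) = 1 / 2"
proof -
  have "coin_prob (\<lambda>\<omega>. \<omega> j) = measure (coin_product UNIV) (prod_emb UNIV (\<lambda>_. measure_pmf (bernoulli_pmf (1 / 2))) {j} (PiE {j} (\<lambda>_. {True})))"
    unfolding coin_space_def
    by (intro arg_cong[where f = "measure _"])
      (auto simp: prod_emb_def space_PiM intro!: restrict_ext dest: fun_cong[of _ _ j])
  also have "\<dots> = 1 / 2"
    by (subst coin.measure_PiM_emb) (auto simp: measure_pmf_single)
  finally show ?thesis .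
qed

lemma coin_prob_all: "coin_prob (\<lambda>\<omega>. \<forall>j<k. \<omega> (i, t, j)) = (1 / 2) ^ k"
proof (induction k)
  case (Suc k)
  have "coin_prob (\<lambda>\<omega>. \<forall>j<Suc k. \<omega> (i, t, j)) =
      coin_prob (\<lambda>\<omega>. (\<forall>j<k. \<omega> (i, t, j)) \<and> \<omega> (i, t, k))"
    by (simp add: All_less_Suc conj_commute)
  also have "\<dots> = coin_prob (\<lambda>\<omega>. \<forall>j<k. \<omega> (i, t, j)) * coin_prob (\<lambda>\<omega>. \<omega> (i, t, k))"
    by (rule coin_prob_conj[of "(\<lambda>j. (i, t, j)) ` {..<k}" "{(i, t, k)}"])
      (auto simp: determined_by_def)
  finally show ?case
    by (simp add: Suc coin_prob_single)
qed (simp add: coin_space_prob_UNIV)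

section \<open>The random set of transmitting stations\<close>

text \<open>Asking \<open>k\<close> fair coins to agree realises the sending probability
  \<open>2 ^ - k\<close>; at level 0 every station of \<open>A\<close> sends.\<close>

definition transmitting :: "nat set \<Rightarrow> nat \<Rightarrow> nat \<Rightarrow> coins \<Rightarrow> nat set" where
  "transmitting A t k \<omega> = {i \<in> A. \<forall>j<k. \<omega> (i, t, j)}"

definition block :: "nat set \<Rightarrow> nat \<Rightarrow> nat \<Rightarrow> (nat \<times> nat \<times> nat) set" where
  "block A t k = A \<times> {t} \<times> {..<k}"

lemma determined_by_transmitting: "determined_by (block A t k) (transmitting A t k)"
  unfolding determined_by_def transmitting_def block_def by auto

text \<open>Stations are added one at a time; the coins of the new station are disjoint from those
  of the others, so each contributes a factor \<open>(1 / 2) ^ k\<close> or its complement.\<close>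

lemma coin_prob_transmitting:
  assumes "finite A" "C \<subseteq> A"
  shows "coin_prob (\<lambda>\<omega>. transmitting A t k \<omega> = C) =
    ((1 / 2) ^ k) ^ card C * (1 - (1 / 2) ^ k) ^ (card A - card C)"
  using assms
proof (induction A arbitrary: C)
  case empty
  then show ?case by (simp add: transmitting_def coin_space_prob_UNIV)
next
  case (insert i A)
  let ?p = "(1 / 2) ^ k :: real"
  let ?D = "C - {i}"
  have D: "?D \<subseteq> A" "finite C" "card ?D \<le> card A"
    using insert by (auto intro: finite_subset card_mono)
  have "coin_prob (\<lambda>\<omega>. transmitting (insert i A) t k \<omega> = C) =
      coin_prob (\<lambda>\<omega>. ((\<forall>j<k. \<omega> (i, t, j)) \<longleftrightarrow> i \<in> C) \<and> transmitting A t k \<omega> = ?D)"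
    using insert.hyps insert.prems
    by (intro arg_cong[where f = "measure _"] Collect_cong) (auto simp: transmitting_def)
  also have "\<dots> = coin_prob (\<lambda>\<omega>. (\<forall>j<k. \<omega> (i, t, j)) \<longleftrightarrow> i \<in> C) *
      coin_prob (\<lambda>\<omega>. transmitting A t k \<omega> = ?D)"
    using insert.hyps
    by (intro coin_prob_conj[of "block {i} t k" "block A t k"]
        determined_by_comp[OF determined_by_transmitting])
      (auto simp: block_def determined_by_def)
  also have "coin_prob (\<lambda>\<omega>. (\<forall>j<k. \<omega> (i, t, j)) \<longleftrightarrow> i \<in> C) = (if i \<in> C then ?p else 1 - ?p)"
    using coin_prob_all[of k i t] coin_prob_not[of "block {i} t k" "\<lambda>\<omega>. \<forall>j<k. \<omega> (i, t, j)"]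
    by (auto simp: block_def determined_by_def)
  also have "coin_prob (\<lambda>\<omega>. transmitting A t k \<omega> = ?D) = ?p ^ card ?D * (1 - ?p) ^ (card A - card ?D)"
    using D by (intro insert.IH) auto
  finally have eq: "coin_prob (\<lambda>\<omega>. transmitting (insert i A) t k \<omega> = C) =
    (if i \<in> C then ?p else 1 - ?p) * (?p ^ card ?D * (1 - ?p) ^ (card A - card ?D))" .
  show ?case
  proof (cases "i \<in> C")
    case True
    then have card: "card C = Suc (card ?D)"
      using D(2) by (intro card.remove)
    show ?thesis
      using True
      by (simp only: eq card card_insert_disjoint[OF insert.hyps] diff_Suc_Suc power_Suc mult.assoc if_True)
  next
    case False
    then have "card (insert i A) - card C = Suc (card A - card ?D)"
      using insert.hyps D by (simp add: Suc_diff_le)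
    then show ?thesis
      using False by (simp only: eq) simp
  qed
qed

context
  fixes A :: "nat set" and t k :: nat
  assumes A: "finite A"
begin

lemma finite_block: "finite (block A t k)"
  using A by (simp add: block_def)

lemma coin_prob_silence: "coin_prob (\<lambda>\<omega>. transmitting A t k \<omega> = {}) = (1 - (1 / 2) ^ k) ^ card A"
  using coin_prob_transmitting[OF A, of "{}"] by simp

lemma coin_prob_success:
  "coin_prob (\<lambda>\<omega>. \<exists>i\<in>A. transmitting A t k \<omega> = {i}) =
     real (card A) * (1 / 2) ^ k * (1 - (1 / 2) ^ k) ^ (card A - 1)"
proof -
  have "{\<omega>. \<exists>i\<in>A. transmitting A t k \<omega> = {i}} = (\<Union>i\<in>A. {\<omega>. transmitting A t k \<omega> = {i}})"
    by auto
  moreover have "{\<omega>. transmitting A t k \<omega> = {i}} \<in> sets coin_space" for i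
    by (rule sets_determined_by[OF finite_block determined_by_comp[OF determined_by_transmitting]])
  ultimately have "coin_prob (\<lambda>\<omega>. \<exists>i\<in>A. transmitting A t k \<omega> = {i}) =
      (\<Sum>i\<in>A. coin_prob (\<lambda>\<omega>. transmitting A t k \<omega> = {i}))"
    using A coin_space.finite_measure_finite_Union[of A "\<lambda>i. {\<omega>. transmitting A t k \<omega> = {i}}"]
    by (simp add: disjoint_family_on_def image_subset_iff disjoint_iff)
  also have "\<dots> = (\<Sum>i\<in>A. (1 / 2) ^ k * (1 - (1 / 2) ^ k) ^ (card A - 1))"
    by (intro sum.cong refl) (simp add: coin_prob_transmitting[OF A])
  finally show ?thesis by simp
qed

lemma coin_prob_silence_or_success:
  "coin_prob (\<lambda>\<omega>. transmitting A t k \<omega> = {} \<or> (\<exists>i\<in>A. transmitting A t k \<omega> = {i})) =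
     coin_prob (\<lambda>\<omega>. transmitting A t k \<omega> = {}) +
     coin_prob (\<lambda>\<omega>. \<exists>i\<in>A. transmitting A t k \<omega> = {i})"
proof -
  have "coin_prob (\<lambda>\<omega>. transmitting A t k \<omega> = {} \<or> (\<exists>i\<in>A. transmitting A t k \<omega> = {i})) =
      measure coin_space ({\<omega>. transmitting A t k \<omega> = {}} \<union>
        {\<omega>. \<exists>i\<in>A. transmitting A t k \<omega> = {i}})"
    by (intro arg_cong[where f = "measure _"]) auto
  also have "\<dots> = coin_prob (\<lambda>\<omega>. transmitting A t k \<omega> = {}) +
      coin_prob (\<lambda>\<omega>. \<exists>i\<in>A. transmitting A t k \<omega> = {i})"
    by (intro coin_space.finite_measure_Union
        sets_determined_by[OF finite_block determined_by_comp[OF determined_by_transmitting]]) auto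
  finally show ?thesis .
qed

lemma coin_prob_collision:
  "coin_prob (\<lambda>\<omega>. \<not> (transmitting A t k \<omega> = {} \<or> (\<exists>i\<in>A. transmitting A t k \<omega> = {i}))) =
     1 - coin_prob (\<lambda>\<omega>. transmitting A t k \<omega> = {}) -
     coin_prob (\<lambda>\<omega>. \<exists>i\<in>A. transmitting A t k \<omega> = {i})"
  using coin_prob_not[OF finite_block determined_by_comp[OF determined_by_transmitting],
      of "\<lambda>B. B = {} \<or> (\<exists>i\<in>A. B = {i})"]
  by (simp add: coin_prob_silence_or_success)

text \<open>Silence, success and collision exhaust the outcomes, so one upper bound per outcome
  (\<open>a\<close>, \<open>b\<close>, \<open>c\<close>) weighted with its probability bounds the
  expectation.\<close>

lemma nn_integral_transmitting:
  assumes nonneg: "0 \<le> a" "0 \<le> b" "0 \<le> c"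
    and bound: "\<And>\<omega>. g (transmitting A t k \<omega>) \<le>
      (if transmitting A t k \<omega> = {} then a else if \<exists>i\<in>A. transmitting A t k \<omega> = {i} then b else c)"
  shows "(\<integral>\<^sup>+ \<omega>. ennreal (g (transmitting A t k \<omega>)) \<partial>coin_space) \<le> ennreal
    (coin_prob (\<lambda>\<omega>. transmitting A t k \<omega> = {}) * a +
     coin_prob (\<lambda>\<omega>. \<exists>i\<in>A. transmitting A t k \<omega> = {i}) * b +
     (1 - coin_prob (\<lambda>\<omega>. transmitting A t k \<omega> = {}) -
      coin_prob (\<lambda>\<omega>. \<exists>i\<in>A. transmitting A t k \<omega> = {i})) * c)"
proof -
  define P Q where "P B \<longleftrightarrow> B = {}" and "Q B \<longleftrightarrow> (\<exists>i\<in>A. B = {i})" for B :: "nat set"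
  define ind where "ind S \<omega> = (of_bool (S (transmitting A t k \<omega>)) :: ennreal)" for S \<omega>
  define R where "R B \<longleftrightarrow> \<not> (P B \<or> Q B)" for B
  have [measurable]: "ind S \<in> borel_measurable coin_space" for S
    unfolding ind_def
    by (rule borel_measurable_determined_by[OF finite_block determined_by_comp[OF determined_by_transmitting]])
  have int: "(\<integral>\<^sup>+ \<omega>. ind S \<omega> \<partial>coin_space) = ennreal (coin_prob (\<lambda>\<omega>. S (transmitting A t k \<omega>)))" for S
    unfolding ind_def
    by (rule nn_integral_of_bool_coin_space[OF finite_block determined_by_comp[OF determined_by_transmitting]])
  have "(\<integral>\<^sup>+ \<omega>. ennreal (g (transmitting A t k \<omega>)) \<partial>coin_space) \<le>
      (\<integral>\<^sup>+ \<omega>. ennreal a * ind P \<omega> + ennreal b * ind Q \<omega> + ennreal c * ind R \<omega> \<partial>coin_space)"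
  proof (rule nn_integral_mono)
    fix \<omega>
    let ?B = "transmitting A t k \<omega>"
    consider "P ?B" "\<not> Q ?B" | "\<not> P ?B" "Q ?B" | "\<not> P ?B" "\<not> Q ?B"
      by (auto simp: P_def Q_def)
    then show "ennreal (g ?B) \<le> ennreal a * ind P \<omega> + ennreal b * ind Q \<omega> + ennreal c * ind R \<omega>"
      using bound[of \<omega>, folded P_def Q_def] by cases (simp_all add: ind_def R_def ennreal_leI)
  qed
  also have "\<dots> = ennreal a * ennreal (coin_prob (\<lambda>\<omega>. P (transmitting A t k \<omega>))) +
      ennreal b * ennreal (coin_prob (\<lambda>\<omega>. Q (transmitting A t k \<omega>))) +
      ennreal c * ennreal (coin_prob (\<lambda>\<omega>. R (transmitting A t k \<omega>)))"
    unfolding int[symmetric] by (simp add: nn_integral_add nn_integral_cmult)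
  also have "\<dots> = ennreal (coin_prob (\<lambda>\<omega>. P (transmitting A t k \<omega>)) * a +
      coin_prob (\<lambda>\<omega>. Q (transmitting A t k \<omega>)) * b + coin_prob (\<lambda>\<omega>. R (transmitting A t k \<omega>)) * c)"
    using nonneg
    by (simp add: ennreal_mult[symmetric] ennreal_plus[symmetric] mult.commute del: ennreal_plus)
  finally show ?thesis
    unfolding P_def Q_def R_def by (simp only: coin_prob_collision)
qed

end


section \<open>Drift of the level\<close>

text \<open>With \<open>L = log 2 N\<close> this equals \<open>2 * L + abs (k - L)\<close>: the
  distance of the level from its target, plus a term that makes the whole monotone in
  \<open>N\<close>.\<close>

definition level_potential :: "nat \<Rightarrow> nat \<Rightarrow> real" where
  "level_potential N k = max (3 * log 2 (real N) - real k) (log 2 (real N) + real k)"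

text \<open>At \<open>N = 0\<close> the logarithm has the default value 0.\<close>

lemma log_nat_nonneg: "0 \<le> log 2 (real N)"
  by (cases "N = 0") (auto simp: log_def)

lemma level_potential_nonneg: "0 \<le> level_potential N k"
  using log_nat_nonneg[of N] by (simp add: level_potential_def le_max_iff_disj)

text \<open>Both branches of the maximum grow with \<open>log 2 N\<close>. Hence the potential never
  rises because stations become inactive.\<close>

lemma level_potential_mono:
  assumes "N \<le> N'"
  shows "level_potential N k \<le> level_potential N' k"
proof -
  have "log 2 (real N) \<le> log 2 (real N')"
  proof (cases "N = 0")
    case True
    then show ?thesis using log_nat_nonneg[of N'] by (simp add: log_def)
  qed (use assms in simp)
  then show ?thesis
    unfolding level_potential_def by (intro max.mono) auto
qed

lemma level_potential_0: "level_potential 0 k = real k"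
  by (simp add: level_potential_def log_def)

lemma level_potential_Suc_le: "level_potential N (Suc k) \<le> level_potential N k + 1"
  by (simp add: level_potential_def max_def)

lemma level_potential_pred_le: "level_potential N (k - 1) \<le> level_potential N k + 1"
  by (cases k) (simp_all add: level_potential_def max_def)

text \<open>The hypothesis keeps the level at or below its target before and after the move, so the
  first branch is the maximum both times.\<close>

lemma level_potential_Suc_eq:
  assumes "real k + 1 \<le> log 2 (real N)"
  shows "level_potential N (Suc k) = level_potential N k - 1"
  using assms by (simp add: level_potential_def max_def)

text \<open>Now the second branch is the maximum before and after the move. The hypothesis forces
  \<open>k\<close> to be positive, so the subtraction does not truncate.\<close>

lemma level_potential_pred_eq:
  assumes "log 2 (real N) \<le> real k - 1"
  shows "level_potential N (k - 1) = level_potential N k - 1"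
  using assms log_nat_nonneg[of N] by (cases k) (simp_all add: level_potential_def max_def)

text \<open>Bernoulli replaces the second factor by \<open>(1 + p) ^ N\<close>, and
  \<open>(1 - p) * (1 + p) \<le> 1\<close>. The result bounds the probability of silence by
  \<open>1 / (1 + N * p)\<close>.\<close>

lemma power_compl_Bernoulli_le:
  fixes p :: real
  assumes "0 \<le> p" "p \<le> 1"
  shows "(1 - p) ^ N * (1 + real N * p) \<le> 1"
proof -
  have "(1 - p) ^ N * (1 + real N * p) \<le> (1 - p) ^ N * (1 + p) ^ N"
    using assms Bernoulli_inequality[of p N] by (intro mult_left_mono) auto
  also have "\<dots> = (1 - p\<^sup>2) ^ N"
    by (simp add: power_mult_distrib[symmetric] power2_eq_square algebra_simps)
  also have "\<dots> \<le> 1"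
    using assms by (intro power_le_one) (auto simp: power_le_one)
  finally show ?thesis .
qed

lemma exp_4_le: "exp 4 \<le> (81 :: real)"
proof -
  have "exp 4 = (exp (1 :: real)) ^ 4"
    by (simp add: exp_of_nat_mult[symmetric])
  also have "\<dots> \<le> 3 ^ 4"
    by (intro power_mono exp_le) simp
  finally show ?thesis by simp
qed

text \<open>For \<open>p \<le> 1 / 2\<close> one has \<open>exp (- 2 * p) \<le> 1 - p\<close>, so
  \<open>(1 - p) ^ N\<close> is at least \<open>exp (- 4)\<close>, hence at least
  \<open>1 / 81\<close>; the factor \<open>N * p\<close> contributes \<open>1 / 2\<close>.\<close>

lemma single_success_ge:
  fixes p :: real
  assumes p: "0 \<le> p" "p \<le> 1 / 2" and "1 / 2 \<le> real N * p" "real N * p \<le> 2"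
  shows "1 / 162 \<le> real N * p * (1 - p) ^ (N - 1)"
proof -
  have "1 \<le> (1 - p) * (1 + 2 * p)"
    using mult_nonneg_nonneg[of p "1 - 2 * p"] p by (simp add: algebra_simps)
  also have "\<dots> \<le> (1 - p) * exp (2 * p)"
    using p by (intro mult_left_mono exp_ge_add_one_self) auto
  finally have "exp (- (2 * p)) \<le> 1 - p"
    by (simp add: exp_minus field_simps)
  then have "exp (- (2 * p)) ^ N \<le> (1 - p) ^ N"
    by (intro power_mono) auto
  moreover have "(1 - p) ^ N \<le> (1 - p) ^ (N - 1)"
    using p by (intro power_decreasing) auto
  moreover have "exp (- (2 * p)) ^ N = exp (- (2 * (real N * p)))"
    by (simp add: exp_of_nat_mult[symmetric] algebra_simps)
  moreover have "exp (- 4) \<le> exp (- (2 * (real N * p)))"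
    unfolding exp_le_cancel_iff using assms by linarith
  moreover have "1 / 81 \<le> exp (- 4 :: real)"
    using exp_4_le by (simp add: exp_minus field_simps)
  ultimately have "1 / 81 \<le> (1 - p) ^ (N - 1)"
    by linarith
  then have "1 / 2 * (1 / 81) \<le> real N * p * (1 - p) ^ (N - 1)"
    using assms by (intro mult_mono) auto
  then show ?thesis by simp
qed

text \<open>
  The expected number \<open>N * p\<close> of transmitting stations is at least 2, at most 1/2, or in between. In
  the first two cases a collision or silence, respectively, moves the level in the right direction
  with high probability; in the last case success is likely enough to pay for a wrong move.
\<close>

lemma level_potential_drift:
  fixes N k :: nat
  defines "p \<equiv> (1 / 2) ^ k :: real"
  defines "silence \<equiv> (1 - p) ^ N" and "success \<equiv> real N * p * (1 - p) ^ (N - 1)"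
  assumes N: "N \<noteq> 0" and total: "silence + success \<le> 1"
  shows "silence * (6 * level_potential N (k - 1)) + success * (6 * level_potential N k - 1296) +
      (1 - silence - success) * (6 * level_potential N (Suc k)) \<le> 6 * level_potential N k - 2"
proof -
  define W where "W = level_potential N k"
  define d where "d = level_potential N (k - 1) - W"
  define u where "u = level_potential N (Suc k) - W"
  define x where "x = real N * p"
  have p: "0 < p" "p \<le> 1"
    by (auto simp: p_def power_le_one)
  have x: "x = real N / 2 ^ k"
    by (simp add: x_def p_def power_divide)
  have nonneg: "0 \<le> silence" "0 \<le> success"
    using p by (auto simp: silence_def success_def)
  have d1: "d \<le> 1" and u1: "u \<le> 1"
    using level_potential_pred_le[of N k] level_potential_Suc_le[of N k]
    by (auto simp: d_def u_def W_def)
  \<comment> \<open>Factor 6 scales the drift \<open>- 1 / 3\<close> at low levels, where silence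
    has probability at most \<open>1 / 3\<close>, to \<open>- 2\<close>. As
    \<open>1296 = 8 * 162\<close>, a success probability of \<open>1 / 162\<close> contributes
    \<open>- 8\<close>, which outweighs a wrong move of cost 6 by 2.\<close>
  have "6 * (silence * d + (1 - silence - success) * u) - 1296 * success \<le> - 2"
  proof -
    consider (low) "real k + 1 \<le> log 2 (real N)" | (high) "log 2 (real N) \<le> real k - 1"
      | (mid) "real k - 1 < log 2 (real N)" "log 2 (real N) < real k + 1"
      by linarith
    then show ?thesis
    proof cases
      case low
      then have "2 powr (real k + 1) \<le> real N"
        using N by (simp add: le_log_iff)
      then have "2 \<le> x"
        by (simp add: x powr_add powr_realpow field_simps)
      have "silence * 3 \<le> silence * (1 + x)"
        using nonneg \<open>2 \<le> x\<close> by (intro mult_left_mono) auto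
      also have "\<dots> \<le> 1"
        unfolding silence_def x_def using p by (intro power_compl_Bernoulli_le) auto
      finally have "silence \<le> 1 / 3" by simp
      moreover have "silence * d \<le> silence"
        using mult_left_mono[OF d1 nonneg(1)] by simp
      moreover have "u = - 1"
        using level_potential_Suc_eq[OF low] by (simp add: u_def W_def)
      ultimately show ?thesis
        using nonneg by simp
    next
      case high
      then have "real N \<le> 2 powr (real k - 1)"
        using N by (simp add: log_le_iff)
      then have "x \<le> 1 / 2"
        by (simp add: x powr_diff powr_realpow field_simps)
      have "0 \<le> x" using p by (simp add: x_def)
      have "1 - x \<le> silence"
        using Bernoulli_inequality[of "- p" N] p by (simp add: silence_def x_def)
      have "real (N - 1) * p \<le> x"
        unfolding x_def using p by (intro mult_right_mono) auto
      then have "1 / 2 \<le> (1 - p) ^ (N - 1)"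
        using Bernoulli_inequality[of "- p" "N - 1"] p \<open>x \<le> 1 / 2\<close> by simp
      then have "x * (1 / 2) \<le> success"
        unfolding success_def x_def[symmetric] using \<open>0 \<le> x\<close> by (intro mult_left_mono)
      moreover have "(1 - silence - success) * u \<le> 1 - silence - success"
        using mult_left_mono[OF u1, of "1 - silence - success"] total by simp
      moreover have "d = - 1"
        using level_potential_pred_eq[OF high] by (simp add: d_def W_def)
      ultimately show ?thesis
        using \<open>1 - x \<le> silence\<close> \<open>0 \<le> x\<close> by simp
    next
      case mid
      have "real N < 2 powr (real k + 1)" "2 powr (real k - 1) < real N"
        using mid N by (simp_all add: log_less_iff less_log_iff)
      then have x2: "x \<le> 2" "1 / 2 \<le> x"
        by (simp_all add: x powr_add powr_diff powr_realpow field_simps)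
      have "1 / 162 \<le> success"
      proof (cases "k = 0")
        \<comment> \<open>Here \<open>p = 1\<close> lies outside the range of
          \<open>single_success_ge\<close>, but \<open>N < 2\<close> leaves a single station, whose
          success is certain.\<close>
        case True
        then have "N = 1"
          using \<open>real N < 2 powr (real k + 1)\<close> N by simp
        then show ?thesis
          using True by (simp add: success_def p_def)
      next
        case False
        then have "p \<le> 1 / 2"
          unfolding p_def using power_decreasing[of 1 k "1 / 2 :: real"] by simp
        then show ?thesis
          unfolding success_def using p x2 by (intro single_success_ge) (auto simp: x_def)
      qed
      moreover have "silence * d \<le> silence"
        using mult_left_mono[OF d1 nonneg(1)] by simp
      moreover have "(1 - silence - success) * u \<le> 1 - silence - success"
        using mult_left_mono[OF u1, of "1 - silence - success"] total by simp
      ultimately show ?thesis by simp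
    qed
  qed
  moreover have "level_potential N (k - 1) = W + d" "level_potential N (Suc k) = W + u"
    by (simp_all add: d_def u_def)
  ultimately show ?thesis
    unfolding W_def[symmetric] by (simp add: algebra_simps)
qed


section \<open>The algorithm and its worst case\<close>

text \<open>A function of the channel feedback alone, so that all stations hold the same copy;
  private coins enter only through what is heard.\<close>

datatype public_state =
  Public_State (clock: nat) (forest: "edge set") (level: nat) (stopped: bool)

fun heard_edges :: "feedback \<Rightarrow> edge set" where
  "heard_edges (Heard (Message (Some e) bits)) = {e}"
| "heard_edges _ = {}"

text \<open>The truncation of \<open>level s - 1\<close> at 0 takes effect only in the step that
  also sets \<open>stopped\<close>.\<close>

definition next_state :: "public_state \<Rightarrow> feedback \<Rightarrow> public_state" where
  "next_state s f = Public_State (Suc (clock s)) (heard_edges f \<union> forest s)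
     (if even (clock s) then level s
      else case f of Silence \<Rightarrow> level s - 1 | Collision \<Rightarrow> Suc (level s) | Heard _ \<Rightarrow> level s)
     (odd (clock s) \<and> f = Silence \<and> level s = 0)"

abbreviation initial_state :: public_state where
  "initial_state \<equiv> Public_State 0 {} 0 False"

definition knowledge :: "(bool list \<times> feedback) list \<Rightarrow> public_state" where
  "knowledge h = foldl next_state initial_state (map snd h)"

definition addable :: "edge set \<Rightarrow> edge \<Rightarrow> bool" where
  "addable F e \<longleftrightarrow> e \<notin> F \<and> acyclic_edges (insert e F)"

text \<open>IDs start at 1 and the clock at 0, so the turn of station \<open>i\<close> is step
  \<open>2 * (i - 1)\<close>. Coins flipped in even steps are ignored.\<close>

definition forest_algorithm :: algorithm where
  "forest_algorithm =
     \<lparr>halts = (\<lambda>v. stopped (knowledge (history v))),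
      flips = (\<lambda>v. level (knowledge (history v))),
      act = (\<lambda>v bs. let s = knowledge (history v) in
        if addable (forest s) (own_edge v) \<and>
           (if even (clock s) then ident v = Suc (clock s div 2) else \<forall>b\<in>set bs. b)
        then Broadcast True [] else Listen)\<rparr>"

lemma knowledge_Nil: "knowledge [] = initial_state"
  by (simp add: knowledge_def)

lemma knowledge_snoc: "knowledge (h @ [(bs, f)]) = next_state (knowledge h) f"
  by (simp add: knowledge_def)

lemma addable_antimono: "F \<subseteq> F' \<Longrightarrow> addable F' e \<Longrightarrow> addable F e"
  unfolding addable_def using acyclic_edges_subset[of "insert e F'" "insert e F"] by auto

text \<open>Subsets of acyclic sets are acyclic, so maximality can be tested one edge at a time,
  each by the station holding it.\<close>

lemma spanning_forest_iff_not_addable: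
  assumes "F \<subseteq> E" "acyclic_edges F"
  shows "spanning_forest E F \<longleftrightarrow> (\<forall>e\<in>E. \<not> addable F e)"
proof
  assume F: "spanning_forest E F"
  show "\<forall>e\<in>E. \<not> addable F e"
  proof (intro ballI notI)
    fix e assume e: "e \<in> E" "addable F e"
    then have "insert e F = F"
      using F by (auto simp: addable_def spanning_forest_def)
    then show False using e by (auto simp: addable_def)
  qed
next
  assume none: "\<forall>e\<in>E. \<not> addable F e"
  have "F' = F" if F': "F \<subseteq> F'" "F' \<subseteq> E" "acyclic_edges F'" for F'
  proof (rule ccontr)
    assume "F' \<noteq> F"
    then obtain e where e: "e \<in> F'" "e \<notin> F" using F' by blast
    then have "addable F e"
      using F' acyclic_edges_subset[of F' "insert e F"] by (simp add: addable_def)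
    then show False using none e F' by blast
  qed
  then show "spanning_forest E F"
    using assms by (auto simp: spanning_forest_def)
qed

definition response :: "(nat \<Rightarrow> edge) \<Rightarrow> nat set \<Rightarrow> feedback" where
  "response held B =
     (if B = {} then Silence
      else if \<exists>i. B = {i} then Heard (Message (Some (held (the_elem B))) []) else Collision)"

lemma response_empty: "response held {} = Silence"
  and response_singleton: "response held {i} = Heard (Message (Some (held i)) [])"
  by (auto simp: response_def)

lemma response_collision: "B \<noteq> {} \<Longrightarrow> (\<And>i. B \<noteq> {i}) \<Longrightarrow> response held B = Collision"
  by (simp add: response_def)

lemma channel_response:
  "channel (\<lambda>i. if i \<in> B then Some (Message (Some (held i)) []) else None) = response held B"
proof -
  have "(\<exists>!i. i \<in> B) \<longleftrightarrow> (\<exists>i. B = {i})" by auto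
  moreover have "(THE i. i \<in> B) = the_elem B" if "B = {i}" for i
    using that by simp
  ultimately show ?thesis
    by (auto simp: channel_def response_def)
qed

locale held_graph =
  fixes n :: nat and E :: "edge set" and held :: "nat \<Rightarrow> edge"
  assumes graph: "simple_graph n E" and held: "bij_betw held {1..card E} E"
begin

definition m :: nat where "m = card E"

lemma held_image: "held ` {1..m} = E"
  using held by (simp add: bij_betw_def m_def)

lemma finite_E: "finite E"
  using graph by (rule simple_graph_finite)

definition active :: "edge set \<Rightarrow> nat set" where
  "active F = {i \<in> {1..m}. addable F (held i)}"

lemma finite_active: "finite (active F)"
  by (simp add: active_def)

lemma active_antimono: "F \<subseteq> F' \<Longrightarrow> active F' \<subseteq> active F"
  unfolding active_def using addable_antimono by blast

lemma active_empty_iff: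
  assumes "F \<subseteq> E" "acyclic_edges F"
  shows "active F = {} \<longleftrightarrow> spanning_forest E F"
proof -
  have "active F = {} \<longleftrightarrow> (\<forall>e\<in>held ` {1..m}. \<not> addable F e)"
    by (auto simp: active_def)
  then show ?thesis
    by (simp only: held_image spanning_forest_iff_not_addable[OF assms])
qed

section \<open>Reduction of the execution to one common public state\<close>

definition senders :: "public_state \<Rightarrow> coins \<Rightarrow> nat set" where
  "senders s \<omega> =
     (if even (clock s) then active (forest s) \<inter> {Suc (clock s div 2)}
      else transmitting (active (forest s)) (clock s) (level s) \<omega>)"

lemma senders_subset: "senders s \<omega> \<subseteq> active (forest s)"
  by (auto simp: senders_def transmitting_def)

text \<open>A stopped state is frozen, in accordance with the histories of halted stations.\<close>

definition after :: "public_state \<Rightarrow> coins \<Rightarrow> public_state" where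
  "after s \<omega> = (if stopped s then s else next_state s (response held (senders s \<omega>)))"

primrec state :: "coins \<Rightarrow> nat \<Rightarrow> public_state" where
  "state \<omega> 0 = initial_state"
| "state \<omega> (Suc t) = after (state \<omega> t) \<omega>"

lemma clock_state: "\<not> stopped (state \<omega> t) \<Longrightarrow> clock (state \<omega> t) = t"
  by (induction t) (auto simp: after_def next_state_def split: if_splits)

lemma stopped_mono: "t \<le> t' \<Longrightarrow> stopped (state \<omega> t) \<Longrightarrow> stopped (state \<omega> t')"
  by (induction t' rule: dec_induct) (auto simp: after_def)

abbreviation hist :: "coins \<Rightarrow> nat \<Rightarrow> nat \<Rightarrow> (bool list \<times> feedback) list" where
  "hist \<equiv> histories forest_algorithm n m held"

lemma transmissions_eq:
  assumes know: "\<And>i. i \<in> {1..m} \<Longrightarrow> knowledge (H i) = s" and "\<not> stopped s" "clock s = t"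
  shows "transmissions forest_algorithm n m held \<omega> t H =
    (\<lambda>i. if i \<in> senders s \<omega> then Some (Message (Some (held i)) []) else None)"
proof
  fix i
  show "transmissions forest_algorithm n m held \<omega> t H i =
    (if i \<in> senders s \<omega> then Some (Message (Some (held i)) []) else None)"
  proof (cases "i \<in> {1..m}")
    case True
    then show ?thesis
      using assms(2,3) know[OF True]
      by (auto simp: transmissions_def running_def forest_algorithm_def view_of_def outcomes_def
          senders_def active_def transmitting_def Let_def)
  next
    case False
    then show ?thesis
      using senders_subset[of s \<omega>] by (auto simp: transmissions_def running_def active_def)
  qed
qed

lemma running_hist:
  assumes "\<And>i. i \<in> {1..m} \<Longrightarrow> knowledge (H i) = s"
  shows "running forest_algorithm n m held H = (if stopped s then {} else {1..m})"
  using assms by (auto simp: running_def forest_algorithm_def view_of_def)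

text \<open>If all stations agree on the public state, the broadcasting ones are exactly its
  \<open>senders\<close>, and the common feedback updates every copy alike.\<close>

lemma knowledge_hist: "i \<in> {1..m} \<Longrightarrow> knowledge (hist \<omega> t i) = state \<omega> t"
proof (induction t arbitrary: i)
  case 0
  then show ?case by (simp add: knowledge_Nil)
next
  case (Suc t)
  show ?case
  proof (cases "stopped (state \<omega> t)")
    case True
    then show ?thesis
      using Suc running_hist[of "hist \<omega> t" "state \<omega> t"] by (simp add: Let_def after_def)
  next
    case False
    then show ?thesis
      using Suc running_hist[of "hist \<omega> t" "state \<omega> t"]
        transmissions_eq[of "hist \<omega> t" "state \<omega> t" t \<omega>]
      by (simp add: Let_def after_def knowledge_snoc channel_response clock_state)
  qed
qed

lemma heard_at_eq:
  assumes "\<not> stopped (state \<omega> t)"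
  shows "heard_at forest_algorithm n m held \<omega> t = response held (senders (state \<omega> t) \<omega>)"
  unfolding heard_at_def
  using transmissions_eq[of "hist \<omega> t" "state \<omega> t" t \<omega>] knowledge_hist assms
  by (simp add: channel_response clock_state)

text \<open>Without stations the execution is terminated from the outset, although
  \<open>state\<close> still evolves; hence the separate case \<open>m = 0\<close>.\<close>

lemma terminated_iff: "terminated forest_algorithm n m held \<omega> t \<longleftrightarrow> m = 0 \<or> stopped (state \<omega> t)"
  unfolding terminated_def using running_hist[of "hist \<omega> t" "state \<omega> t"] knowledge_hist by auto

section \<open>Correctness of the revealed forest\<close>

definition forest_ok :: "public_state \<Rightarrow> bool" where
  "forest_ok s \<longleftrightarrow> forest s \<subseteq> E \<and> acyclic_edges (forest s) \<and> (stopped s \<longrightarrow> active (forest s) = {})"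

lemma heard_edges_response:
  "heard_edges (response held B) = (if \<exists>i. B = {i} then held ` B else {})"
  by (auto simp: response_def)

text \<open>Only active stations send, so a success keeps the forest acyclic. At level 0 all of them
  send, so silence there means that none is left.\<close>

lemma forest_ok_after:
  assumes "forest_ok s"
  shows "forest_ok (after s \<omega>)"
proof (cases "stopped s")
  case False
  define B where "B = senders s \<omega>"
  have B: "B \<subseteq> active (forest s)"
    unfolding B_def by (rule senders_subset)
  show ?thesis
  proof (cases "\<exists>i. B = {i}")
    case True
    then obtain i where i: "B = {i}" by blast
    then have "i \<in> active (forest s)" using B by blast
    then have "held i \<in> E" "addable (forest s) (held i)"
      using held_image by (auto simp: active_def)
    then show ?thesis
      using False assms i
      by (simp add: forest_ok_def after_def next_state_def B_def[symmetric] response_singleton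
          addable_def)
  next
    case nosingle: False
    have "B = {} \<Longrightarrow> active (forest s) = {}" if "odd (clock s)" "level s = 0"
      using that by (simp add: B_def senders_def transmitting_def)
    moreover have "response held B = Silence \<Longrightarrow> B = {}"
      by (auto simp: response_def split: if_splits)
    ultimately show ?thesis
      using False assms nosingle
      by (auto simp: forest_ok_def after_def next_state_def B_def[symmetric] heard_edges_response)
  qed
qed (use assms in \<open>simp add: after_def\<close>)

lemma forest_ok_state: "forest_ok (state \<omega> t)"
  by (induction t) (auto simp: forest_ok_after, simp add: forest_ok_def acyclic_edges_empty)

lemma forest_after_mono: "forest s \<subseteq> forest (after s \<omega>)"
  by (auto simp: after_def next_state_def)

section \<open>Termination within linear time\<close>

text \<open>In its turn, a station that is still active sends alone and its edge joins the forest. A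
  station that is inactive once stays so as the forest grows.\<close>

lemma round_robin:
  assumes "i \<in> {1..m}" "2 * (i - 1) < t" "\<not> stopped (state \<omega> t)"
  shows "\<not> addable (forest (state \<omega> t)) (held i)"
  using assms
proof (induction t)
  case (Suc t)
  define s where "s = state \<omega> t"
  have run: "\<not> stopped s"
    using Suc.prems(3) by (auto simp: s_def after_def split: if_splits)
  then have t: "clock s = t"
    using clock_state by (simp add: s_def)
  show ?case
  proof (cases "2 * (i - 1) < t")
    case True
    then show ?thesis
      using Suc run addable_antimono[OF forest_after_mono] by (auto simp: s_def)
  next
    case False
    then have i: "t = 2 * (i - 1)" using Suc.prems by simp
    show ?thesis
    proof
      assume add: "addable (forest (state \<omega> (Suc t))) (held i)"
      then have "addable (forest s) (held i)"
        using addable_antimono[OF forest_after_mono] by (auto simp: s_def)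
      then have "senders s \<omega> = {i}"
        using i t Suc.prems(1) by (auto simp: senders_def active_def)
      then have "held i \<in> forest (state \<omega> (Suc t))"
        using run by (simp add: s_def[symmetric] after_def next_state_def response_singleton)
      then show False using add by (simp add: addable_def)
    qed
  qed
qed simp

text \<open>The level rises at most once per two steps. After \<open>2 * m\<close> steps every
  station has had its turn, so each odd step is silent and lowers the level by one, which keeps the
  sum with \<open>t div 2\<close> from growing.\<close>

lemma level_bound:
  assumes "\<not> stopped (state \<omega> t)"
  shows "level (state \<omega> t) \<le> t div 2" and "2 * m \<le> t \<Longrightarrow> level (state \<omega> t) + t div 2 \<le> 2 * m"
proof -
  have "level (state \<omega> t) \<le> t div 2 \<and> (2 * m \<le> t \<longrightarrow> level (state \<omega> t) + t div 2 \<le> 2 * m)"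
    using assms
  proof (induction t)
    case (Suc t)
    define s where "s = state \<omega> t"
    have run: "\<not> stopped s"
      using Suc.prems by (auto simp: s_def after_def split: if_splits)
    then have t: "clock s = t"
      using clock_state by (simp add: s_def)
    have IH: "level s \<le> t div 2" "2 * m \<le> t \<Longrightarrow> level s + t div 2 \<le> 2 * m"
      using Suc.IH run by (auto simp: s_def)
    have step: "state \<omega> (Suc t) = next_state s (response held (senders s \<omega>))"
      using run by (simp add: s_def after_def)
    show ?case
    proof (cases "even t")
      case True
      then have "level (state \<omega> (Suc t)) = level s" "Suc t div 2 = t div 2"
        using t by (simp_all add: step next_state_def del: state.simps)
      then show ?thesis
        using IH True by (auto elim!: evenE)
    next
      case False
      have div: "Suc t div 2 = Suc (t div 2)" using False by (auto elim!: oddE)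
      show ?thesis
      proof (cases "2 * m \<le> t")
        case True
        have "\<not> addable (forest s) (held i)" if "i \<in> {1..m}" for i
          unfolding s_def
        proof (rule round_robin[OF that])
          show "2 * (i - 1) < t" using that True by (cases i) auto
        qed (use run in \<open>simp add: s_def\<close>)
        then have "active (forest s) = {}" by (auto simp: active_def)
        then have "senders s \<omega> = {}" using senders_subset[of s \<omega>] by simp
        \<comment> \<open>Silence at level 0 would have stopped the execution, so the decrement is a
          real one.\<close>
        then have "level s \<noteq> 0" "level (state \<omega> (Suc t)) = level s - 1"
          using Suc.prems False t by (auto simp: step next_state_def response_empty simp del: state.simps)
        then show ?thesis
          using IH True div by auto
      next
        case before: False
        have "level (state \<omega> (Suc t)) \<le> Suc (level s)"
          by (auto simp: step next_state_def simp del: state.simps split: feedback.splits)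
        then show ?thesis
          using IH div before by auto
      qed
    qed
  qed simp
  then show "level (state \<omega> t) \<le> t div 2" "2 * m \<le> t \<Longrightarrow> level (state \<omega> t) + t div 2 \<le> 2 * m"
    by auto
qed

lemma stopped_late: "stopped (state \<omega> (4 * m + 2))"
proof (rule ccontr)
  assume "\<not> stopped (state \<omega> (4 * m + 2))"
  then have "(4 * m + 2) div 2 \<le> 2 * m"
    using level_bound(2)[of \<omega> "4 * m + 2"] by simp
  then show False by simp
qed

definition stop_time :: "coins \<Rightarrow> nat" where
  "stop_time \<omega> = (if m = 0 then 0 else LEAST t. stopped (state \<omega> t))"

lemma stopped_iff_stop_time:
  assumes "m \<noteq> 0"
  shows "stopped (state \<omega> t) \<longleftrightarrow> stop_time \<omega> \<le> t"
proof
  show "stop_time \<omega> \<le> t" if "stopped (state \<omega> t)"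
    using that by (simp add: stop_time_def Least_le)
  have "stopped (state \<omega> (stop_time \<omega>))"
    using LeastI[of "\<lambda>t. stopped (state \<omega> t)", OF stopped_late] assms by (simp add: stop_time_def)
  then show "stopped (state \<omega> t)" if "stop_time \<omega> \<le> t"
    using stopped_mono[OF that] by simp
qed

lemma running_time_eq: "running_time forest_algorithm n m held \<omega> = enat (stop_time \<omega>)"
proof -
  have "terminated forest_algorithm n m held \<omega> t \<longleftrightarrow> stop_time \<omega> \<le> t" for t
  proof (cases "m = 0")
    case True
    then have "stop_time \<omega> = 0" by (simp add: stop_time_def)
    then show ?thesis unfolding terminated_iff using True by simp
  next
    case False
    then show ?thesis unfolding terminated_iff using stopped_iff_stop_time[OF False] by simp
  qed
  then have "{t. terminated forest_algorithm n m held \<omega> t} = {stop_time \<omega>..}"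
    by auto
  then have "running_time forest_algorithm n m held \<omega> = (INF t\<in>{stop_time \<omega>..}. enat t)"
    by (simp only: running_time_def)
  also have "\<dots> = enat (stop_time \<omega>)"
    by (rule antisym, rule INF_lower, simp, rule INF_greatest, simp)
  finally show ?thesis .
qed

lemma running_time_le: "running_time forest_algorithm n m held \<omega> \<le> enat (6 * m)"
proof (cases "m = 0")
  case False
  have "stop_time \<omega> \<le> 4 * m + 2"
    by (rule stopped_iff_stop_time[OF False, THEN iffD1, OF stopped_late])
  \<comment> \<open>\<open>m \<ge> 1\<close> absorbs the additive 2 into a multiple of
    \<open>m\<close>.\<close>
  then show ?thesis unfolding running_time_eq using False by simp
next
  case True
  then have "stop_time \<omega> = 0" by (simp add: stop_time_def)
  then show ?thesis unfolding running_time_eq by simp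
qed

text \<open>An edge enters the forest only by being heard, and the bound on \<open>t\<close> places
  that step before termination.\<close>

lemma forest_revealed:
  assumes "t \<le> stop_time \<omega>" "m \<noteq> 0"
  shows "forest (state \<omega> t) \<subseteq> revealed forest_algorithm n m held \<omega>"
  using assms(1)
proof (induction t)
  case (Suc t)
  have run: "\<not> stopped (state \<omega> t)"
    using stopped_iff_stop_time[OF assms(2)] Suc.prems by simp
  have "e \<in> revealed forest_algorithm n m held \<omega>"
    if "e \<in> heard_edges (response held (senders (state \<omega> t) \<omega>))" for e
  proof -
    obtain i where "senders (state \<omega> t) \<omega> = {i}" "e = held i"
      using \<open>e \<in> _\<close> by (auto simp: heard_edges_response split: if_splits)
    then have "heard_at forest_algorithm n m held \<omega> t = Heard (Message (Some e) [])"
      using heard_at_eq[OF run] by (simp add: response_singleton)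
    then show ?thesis
      unfolding revealed_def running_time_eq using Suc.prems by (auto simp: Suc_le_eq)
  qed
  then show ?case
    using Suc run by (auto simp: after_def next_state_def)
qed simp

lemma spanning_forest_revealed:
  "\<exists>T. spanning_forest E T \<and> T \<subseteq> revealed forest_algorithm n m held \<omega>"
proof (cases "m = 0")
  case True
  then have "spanning_forest E {}"
    using finite_E by (simp add: m_def spanning_forest_def acyclic_edges_empty)
  then show ?thesis by blast
next
  case False
  define F where "F = forest (state \<omega> (stop_time \<omega>))"
  have "stopped (state \<omega> (stop_time \<omega>))"
    using stopped_iff_stop_time[OF False] by simp
  then have "F \<subseteq> E" "acyclic_edges F" "active F = {}"
    using forest_ok_state[of \<omega> "stop_time \<omega>"] by (auto simp: forest_ok_def F_def)
  then have "spanning_forest E F"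
    by (simp add: active_empty_iff)
  then show ?thesis
    using forest_revealed[of "stop_time \<omega>" \<omega>] False F_def by blast
qed

end


section \<open>Expected time\<close>

context held_graph
begin

lemma determined_by_after:
  assumes "\<not> stopped s"
  shows "determined_by (block {1..m} (clock s) (level s)) (after s)"
proof -
  have "determined_by (block {1..m} (clock s) (level s)) (senders s)"
    by (rule determined_by_mono[of "block (active (forest s)) (clock s) (level s)"])
      (auto simp: senders_def determined_by_def transmitting_def block_def active_def)
  then show ?thesis
    unfolding after_def using assms
    by (simp add: determined_by_comp[of _ "senders s" "\<lambda>B. next_state s (response held B)"])
qed

text \<open>Only coins of earlier steps have been read, and \<open>level_bound\<close> limits how
  many of them belong to one station in one step. Hence the coins of step \<open>t\<close> are
  fresh.\<close>

lemma determined_by_state: "determined_by ({1..m} \<times> {..<t} \<times> {..<t}) (\<lambda>\<omega>. state \<omega> t)"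
proof (induction t)
  case 0
  show ?case by (simp add: determined_by_def)
next
  case (Suc t)
  show ?case
    unfolding determined_by_def
  proof (intro allI impI)
    fix \<omega> \<omega>' :: coins
    assume agree: "\<forall>j\<in>{1..m} \<times> {..<Suc t} \<times> {..<Suc t}. \<omega> j = \<omega>' j"
    define s where "s = state \<omega> t"
    have s': "state \<omega>' t = s"
      unfolding s_def using agree by (intro determined_byD[OF Suc, symmetric]) auto
    have "after s \<omega> = after s \<omega>'"
    proof (cases "stopped s")
      case True
      then show ?thesis by (simp add: after_def)
    next
      case False
      have "clock s = t" "level s \<le> t div 2"
        using clock_state[of \<omega> t] level_bound(1)[of \<omega> t] False by (auto simp: s_def)
      then show ?thesis
        using agree by (intro determined_byD[OF determined_by_after[OF False]]) (auto simp: block_def)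
    qed
    then show "state \<omega> (Suc t) = state \<omega>' (Suc t)"
      by (simp add: s' s_def[symmetric])
  qed
qed

end

locale bounded_forest = held_graph +
  fixes R :: nat
  assumes card_forest: "F \<subseteq> E \<Longrightarrow> acyclic_edges F \<Longrightarrow> card F \<le> R"
begin

section \<open>The potential and its drift\<close>

text \<open>The weights 1296 and 6 are those of \<open>level_potential_drift\<close>. The summand 2
  makes the final silent step, which drops the potential to 0, pay for itself.\<close>

definition base_potential :: "edge set \<Rightarrow> nat \<Rightarrow> real" where
  "base_potential F k =
     1296 * (real R - real (card F)) + 6 * level_potential (card (active F)) k + 2"

text \<open>The last summand pays for the even steps.\<close>

definition potential :: "public_state \<Rightarrow> real" where
  "potential s =
     (if stopped s then 0 else base_potential (forest s) (level s) + of_bool (even (clock s)))"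

lemma base_potential_ge:
  assumes "F \<subseteq> E" "acyclic_edges F"
  shows "2 \<le> base_potential F k"
  using card_forest[OF assms] level_potential_nonneg[of "card (active F)" k]
  by (simp add: base_potential_def)

lemma base_potential_insert:
  assumes "F \<subseteq> E" "i \<in> active F"
  shows "base_potential (insert (held i) F) k \<le> base_potential F k - 1296"
proof -
  have "finite F" using assms(1) finite_E by (rule finite_subset)
  then have "card (insert (held i) F) = Suc (card F)"
    using assms(2) by (simp add: active_def addable_def)
  moreover have "card (active (insert (held i) F)) \<le> card (active F)"
    by (intro card_mono finite_active active_antimono) auto
  ultimately show ?thesis
    using level_potential_mono[of "card (active (insert (held i) F))" "card (active F)" k]
    by (simp add: base_potential_def)
qed

text \<open>Serves the steps in which the drop is certain: the even ones and those without active
  stations.\<close>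

lemma potential_drift_const:
  assumes "\<And>\<omega>. potential (after s \<omega>) \<le> potential s - 1" "1 \<le> potential s"
  shows "(\<integral>\<^sup>+ \<omega>. ennreal (potential (after s \<omega>)) \<partial>coin_space) + 1 \<le> ennreal (potential s)"
proof -
  have "(\<integral>\<^sup>+ \<omega>. ennreal (potential (after s \<omega>)) \<partial>coin_space) \<le>
      (\<integral>\<^sup>+ \<omega>. ennreal (potential s - 1) \<partial>coin_space)"
    by (intro nn_integral_mono ennreal_leI assms(1))
  also have "\<dots> = ennreal (potential s - 1)"
    by (simp add: coin_space.emeasure_space_1)
  finally have "(\<integral>\<^sup>+ \<omega>. ennreal (potential (after s \<omega>)) \<partial>coin_space) + 1 \<le> ennreal (potential s - 1) + 1"
    by (rule add_right_mono)
  also have "\<dots> = ennreal (potential s)"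
    using assms(2) by (simp add: ennreal_1[symmetric] ennreal_plus[symmetric] del: ennreal_1 ennreal_plus)
  finally show ?thesis .
qed

text \<open>An even step gives up the parity bonus of 1, and a success there only helps. An odd step
  regains the bonus, so the base potential must fall by 2 in expectation.\<close>

lemma potential_drift:
  assumes ok: "forest_ok s" and run: "\<not> stopped s"
  shows "(\<integral>\<^sup>+ \<omega>. ennreal (potential (after s \<omega>)) \<partial>coin_space) + 1 \<le> ennreal (potential s)"
proof -
  define F k where "F = forest s" and "k = level s"
  have F: "F \<subseteq> E" "acyclic_edges F"
    using ok by (auto simp: forest_ok_def F_def)
  have base: "2 \<le> base_potential F k'" for k'
    using F by (rule base_potential_ge)
  have pot: "potential s = base_potential F k + of_bool (even (clock s))"
    using run by (simp add: potential_def F_def k_def)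
  have after: "after s \<omega> = next_state s (response held (senders s \<omega>))" for \<omega>
    using run by (simp add: after_def)
  show ?thesis
  proof (cases "even (clock s)")
    case True
    have "potential (after s \<omega>) \<le> potential s - 1" for \<omega>
    proof (cases "\<exists>i. senders s \<omega> = {i}")
      case False
      then have "heard_edges (response held (senders s \<omega>)) = {}"
        by (simp only: heard_edges_response if_False)
      then show ?thesis
        using True run by (simp add: after potential_def next_state_def)
    next
      case single: True
      then obtain i where i: "senders s \<omega> = {i}" by blast
      then have "i \<in> active F"
        using senders_subset[of s \<omega>] by (auto simp: F_def)
      then show ?thesis
        using True run base_potential_insert[OF F(1), of i k]
        by (simp add: after potential_def next_state_def i response_singleton F_def k_def)
    qed
    then show ?thesis
      using base[of k] by (intro potential_drift_const) (auto simp: pot)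
  next
    case odd: False
    define A where "A = active F"
    define N where "N = card A"
    have senders: "senders s \<omega> = transmitting A (clock s) k \<omega>" for \<omega>
      using odd by (simp add: senders_def A_def F_def k_def)
    show ?thesis
    \<comment> \<open>Without active stations the step is surely silent: either the execution stops,
      or the level falls and the base potential drops by 6, against a bonus of 1.\<close>
    proof (cases "A = {}")
      case True
      then have "senders s \<omega> = {}" for \<omega>
        by (simp add: senders transmitting_def)
      then have "potential (after s \<omega>) \<le> potential s - 1" for \<omega>
        using odd True run base[of k]
        by (simp add: after response_empty next_state_def potential_def F_def[symmetric]
            k_def[symmetric]) (simp add: base_potential_def A_def level_potential_0)
      then show ?thesis
        using base[of k] by (intro potential_drift_const) (auto simp: pot)
    next
      case False
      have A: "finite A" by (simp add: A_def finite_active)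
      then have N: "N \<noteq> 0" using False by (simp add: N_def)
      let ?silence = "coin_prob (\<lambda>\<omega>. transmitting A (clock s) k \<omega> = {})"
      let ?success = "coin_prob (\<lambda>\<omega>. \<exists>i\<in>A. transmitting A (clock s) k \<omega> = {i})"
      define g where "g B = potential (next_state s (response held B))" for B
      \<comment> \<open>Collects all that does not depend on the level, including the bonus of the
        even step that follows.\<close>
      define c where "c = 1296 * (real R - real (card F)) + 3"
      have phi: "base_potential F k' + 1 = c + 6 * level_potential N k'" for k'
        by (simp add: base_potential_def c_def N_def A_def)
      have single: "0 \<le> base_potential F k' - 1296" "g {i} \<le> base_potential F k - 1296 + 1"
        if "i \<in> A" for i k'
      proof -
        have i: "held i \<in> E" "acyclic_edges (insert (held i) F)"
          using that held_image by (auto simp: A_def active_def addable_def)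
        show "0 \<le> base_potential F k' - 1296"
          using base_potential_insert[OF F(1), of i k'] that base_potential_ge[OF _ i(2), of k'] i(1) F(1)
          by (simp add: A_def)
        show "g {i} \<le> base_potential F k - 1296 + 1"
          using base_potential_insert[OF F(1), of i k] that odd
          by (simp add: g_def potential_def next_state_def response_singleton A_def F_def k_def)
      qed
      have "(\<integral>\<^sup>+ \<omega>. ennreal (g (transmitting A (clock s) k \<omega>)) \<partial>coin_space) \<le>
        ennreal (?silence * (base_potential F (k - 1) + 1) + ?success * (base_potential F k - 1296 + 1) +
          (1 - ?silence - ?success) * (base_potential F (Suc k) + 1))"
      proof (rule nn_integral_transmitting[OF A])
        show "0 \<le> base_potential F (k - 1) + 1" "0 \<le> base_potential F (Suc k) + 1"
          using base[of "k - 1"] base[of "Suc k"] by auto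
        show "0 \<le> base_potential F k - 1296 + 1"
          using False single(1)[of _ k] by fastforce
        fix \<omega>
        let ?B = "transmitting A (clock s) k \<omega>"
        consider "?B = {}" | i where "i \<in> A" "?B = {i}" | "?B \<noteq> {}" "\<not> (\<exists>i\<in>A. ?B = {i})"
          by blast
        then show "g ?B \<le> (if ?B = {} then base_potential F (k - 1) + 1
          else if \<exists>i\<in>A. ?B = {i} then base_potential F k - 1296 + 1 else base_potential F (Suc k) + 1)"
        proof cases
          \<comment> \<open>For \<open>k = 0\<close> the next state is stopped and has potential 0,
            below the nonnegative bound; otherwise the level moves to \<open>k - 1\<close>.\<close>
          case 1
          then show ?thesis
            using odd base[of 0]
            by (auto simp: g_def potential_def next_state_def response_empty F_def k_def)
        next
          case 2
          then show ?thesis using single(2) by auto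
        next
          case 3
          have "response held ?B = Collision"
            using 3 by (intro response_collision) (auto simp: transmitting_def)
          then have "g ?B = base_potential F (Suc k) + 1"
            using odd by (simp add: g_def potential_def next_state_def F_def k_def)
          then show ?thesis using 3 by simp
        qed
      qed
      also have "?silence * (base_potential F (k - 1) + 1) + ?success * (base_potential F k - 1296 + 1) +
          (1 - ?silence - ?success) * (base_potential F (Suc k) + 1) \<le> base_potential F k - 1"
      proof -
        have le1: "?silence + ?success \<le> 1"
          unfolding coin_prob_silence_or_success[OF A, symmetric] by (rule coin_space.prob_le_1)
        have "?silence * (6 * level_potential N (k - 1)) + ?success * (6 * level_potential N k - 1296) +
            (1 - ?silence - ?success) * (6 * level_potential N (Suc k)) \<le> 6 * level_potential N k - 2"
          using level_potential_drift[of N k] N le1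
          unfolding coin_prob_silence[OF A] coin_prob_success[OF A] N_def by blast
        then have "?silence * (c + 6 * level_potential N (k - 1)) +
            ?success * (c + 6 * level_potential N k - 1296) +
            (1 - ?silence - ?success) * (c + 6 * level_potential N (Suc k)) \<le>
            c + 6 * level_potential N k - 2"
          by (simp add: algebra_simps)
        then show ?thesis
          using phi[of "k - 1"] phi[of k] phi[of "Suc k"] by (simp add: algebra_simps)
      qed
      finally have "(\<integral>\<^sup>+ \<omega>. ennreal (potential (after s \<omega>)) \<partial>coin_space) \<le> ennreal (base_potential F k - 1)"
        by (simp add: after senders g_def ennreal_leI)
      then have "(\<integral>\<^sup>+ \<omega>. ennreal (potential (after s \<omega>)) \<partial>coin_space) + 1 \<le>
          ennreal (base_potential F k - 1) + 1"
        by (rule add_right_mono)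
      also have "\<dots> = ennreal (potential s)"
        using base[of k] odd
        by (simp add: pot ennreal_1[symmetric] ennreal_plus[symmetric] del: ennreal_1 ennreal_plus)
      finally show ?thesis .
    qed
  qed
qed

section \<open>From the drift to the expected time\<close>

text \<open>The state before step \<open>t\<close> and the coins of step \<open>t\<close> are
  independent. Resampling the latter lets \<open>potential_drift\<close> be applied pointwise at a
  fixed state.\<close>

lemma expected_potential_step:
  "(\<integral>\<^sup>+ \<omega>. ennreal (potential (state \<omega> (Suc t))) \<partial>coin_space) +
     (\<integral>\<^sup>+ \<omega>. of_bool (\<not> stopped (state \<omega> t)) \<partial>coin_space) \<le>
   (\<integral>\<^sup>+ \<omega>. ennreal (potential (state \<omega> t)) \<partial>coin_space)"
proof -
  let ?J = "{1..m} \<times> {..<t} \<times> {..<t}"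
  let ?J' = "block {1..m} t t"
  define h where "h s = (\<integral>\<^sup>+ \<omega>'. ennreal (potential (after s \<omega>')) \<partial>coin_space)" for s
  have J: "finite ?J" "finite ?J'" "?J \<inter> ?J' = {}"
    by (auto simp: block_def)
  have meas: "(\<lambda>\<omega>. f (state \<omega> t)) \<in> borel_measurable coin_space" for f :: "public_state \<Rightarrow> ennreal"
    by (rule borel_measurable_determined_by[OF J(1) determined_by_comp[OF determined_by_state]])
  have "determined_by ?J' (\<lambda>\<omega>'. ennreal (potential (after (state \<omega> t) \<omega>')))" for \<omega>
  proof (cases "stopped (state \<omega> t)")
    case True
    then show ?thesis by (simp add: after_def determined_by_def)
  next
    case False
    then have "block {1..m} (clock (state \<omega> t)) (level (state \<omega> t)) \<subseteq> ?J'"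
      using clock_state[of \<omega> t] level_bound(1)[of \<omega> t] by (auto simp: block_def)
    then show ?thesis
      using determined_by_mono[OF determined_by_after[OF False]]
      by (intro determined_by_comp[of _ "after (state \<omega> t)" "\<lambda>s. ennreal (potential s)"])
  qed
  moreover have "determined_by ?J (\<lambda>\<omega>. ennreal (potential (after (state \<omega> t) \<omega>')))" for \<omega>'
    by (rule determined_by_comp[OF determined_by_state, where g = "\<lambda>s. ennreal (potential (after s \<omega>'))"])
  ultimately have "(\<integral>\<^sup>+ \<omega>. ennreal (potential (state \<omega> (Suc t))) \<partial>coin_space) = (\<integral>\<^sup>+ \<omega>. h (state \<omega> t) \<partial>coin_space)"
    unfolding h_def state.simps
    using nn_integral_coin_space_resample[OF J, of "\<lambda>\<omega> \<omega>'. ennreal (potential (after (state \<omega> t) \<omega>'))"]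
    by blast
  then have "(\<integral>\<^sup>+ \<omega>. ennreal (potential (state \<omega> (Suc t))) \<partial>coin_space) +
      (\<integral>\<^sup>+ \<omega>. of_bool (\<not> stopped (state \<omega> t)) \<partial>coin_space) =
      (\<integral>\<^sup>+ \<omega>. h (state \<omega> t) + of_bool (\<not> stopped (state \<omega> t)) \<partial>coin_space)"
    by (simp only: nn_integral_add[OF meas[of h] meas[of "\<lambda>s. of_bool (\<not> stopped s)"]])
  also have "\<dots> \<le> (\<integral>\<^sup>+ \<omega>. ennreal (potential (state \<omega> t)) \<partial>coin_space)"
  proof (rule nn_integral_mono)
    fix \<omega>
    show "h (state \<omega> t) + of_bool (\<not> stopped (state \<omega> t)) \<le> ennreal (potential (state \<omega> t))"
    proof (cases "stopped (state \<omega> t)")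
      case True
      then show ?thesis by (simp add: h_def after_def potential_def)
    next
      case False
      then show ?thesis
        using potential_drift[OF forest_ok_state False] by (simp add: h_def)
    qed
  qed
  finally show ?thesis .
qed

lemma expected_potential_sum:
  "(\<integral>\<^sup>+ \<omega>. ennreal (potential (state \<omega> t)) \<partial>coin_space) +
     (\<Sum>t'<t. \<integral>\<^sup>+ \<omega>. of_bool (\<not> stopped (state \<omega> t')) \<partial>coin_space) \<le> ennreal (potential initial_state)"
proof (induction t)
  case 0
  show ?case by (simp add: coin_space.emeasure_space_1)
next
  case (Suc t)
  have "(\<integral>\<^sup>+ \<omega>. ennreal (potential (state \<omega> (Suc t))) \<partial>coin_space) +
      (\<Sum>t'<Suc t. \<integral>\<^sup>+ \<omega>. of_bool (\<not> stopped (state \<omega> t')) \<partial>coin_space) =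
    ((\<integral>\<^sup>+ \<omega>. ennreal (potential (state \<omega> (Suc t))) \<partial>coin_space) +
      (\<integral>\<^sup>+ \<omega>. of_bool (\<not> stopped (state \<omega> t)) \<partial>coin_space)) +
      (\<Sum>t'<t. \<integral>\<^sup>+ \<omega>. of_bool (\<not> stopped (state \<omega> t')) \<partial>coin_space)"
    by (simp only: sum.lessThan_Suc ac_simps)
  also have "\<dots> \<le> (\<integral>\<^sup>+ \<omega>. ennreal (potential (state \<omega> t)) \<partial>coin_space) +
      (\<Sum>t'<t. \<integral>\<^sup>+ \<omega>. of_bool (\<not> stopped (state \<omega> t')) \<partial>coin_space)"
    by (intro add_right_mono expected_potential_step)
  also have "\<dots> \<le> ennreal (potential initial_state)"
    by (rule Suc)
  finally show ?case .
qed

text \<open>The running time counts the steps not yet stopped. The worst-case bound makes this a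
  finite sum, whose expectation the telescoped drift controls.\<close>

lemma expected_time_le:
  assumes "m \<noteq> 0"
  shows "expected_time forest_algorithm n m held \<le> ennreal (potential initial_state)"
proof -
  have "ennreal_of_enat (running_time forest_algorithm n m held \<omega>) =
      (\<Sum>t<6 * m. of_bool (\<not> stopped (state \<omega> t)))" for \<omega>
  proof -
    have "stop_time \<omega> \<le> 6 * m"
      using running_time_le[of \<omega>] by (simp add: running_time_eq)
    then have "{..<6 * m} \<inter> {t. t < stop_time \<omega>} = {..<stop_time \<omega>}" by auto
    then have "(\<Sum>t<6 * m. of_bool (t < stop_time \<omega>) :: ennreal) = of_nat (stop_time \<omega>)"
      by (simp add: sum_of_bool_eq)
    then show ?thesis
      by (simp add: running_time_eq stopped_iff_stop_time[OF assms] not_le)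
  qed
  then have "expected_time forest_algorithm n m held =
      (\<integral>\<^sup>+ \<omega>. (\<Sum>t<6 * m. of_bool (\<not> stopped (state \<omega> t))) \<partial>coin_space)"
    by (simp only: expected_time_def)
  also have "\<dots> = (\<Sum>t<6 * m. \<integral>\<^sup>+ \<omega>. of_bool (\<not> stopped (state \<omega> t)) \<partial>coin_space)"
    by (intro nn_integral_sum borel_measurable_determined_by[OF _ determined_by_comp[OF determined_by_state]])
      simp
  also have "\<dots> \<le> ennreal (potential initial_state)"
    using expected_potential_sum[of "6 * m"] by (meson add_increasing order_trans zero_le order_refl)
  finally show ?thesis .
qed

end

lemma (in held_graph) expected_time_linear:
  assumes T: "spanning_forest E T"
  shows "expected_time forest_algorithm n m held \<le> of_nat (2667 * card T)"
proof (cases "m = 0")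
  case True
  then have "stop_time \<omega> = 0" for \<omega>
    by (simp add: stop_time_def)
  then show ?thesis
    by (simp add: expected_time_def running_time_eq)
next
  case False
  interpret bounded_forest n E held "2 * card T"
    by unfold_locales (rule spanning_forest_card_acyclic[OF graph T])
  have m: "m \<le> (2 * card T)\<^sup>2"
    using spanning_forest_card_edges[OF graph T] by (simp add: m_def)
  \<comment> \<open>Nonemptiness of \<open>T\<close> lets additive constants be absorbed into
    multiples of \<open>card T\<close>.\<close>
  have "card T \<noteq> 0"
    using m False by (intro notI) simp
  then have T1: "1 \<le> card T" by simp
  \<comment> \<open>The square turns into a factor 2, and a logarithm is at most its argument, which
    gives \<open>4 * card T\<close>.\<close>
  have "log 2 (real m) \<le> log 2 (real ((2 * card T)\<^sup>2))"
  proof (rule log_mono)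
    show "real m \<le> real ((2 * card T)\<^sup>2)"
      using m by (simp only: of_nat_le_iff)
  qed (use False in simp_all)
  also have "\<dots> = 2 * log 2 (real (2 * card T))"
    unfolding of_nat_power using T1 by (subst log_nat_power) simp_all
  also have "log 2 (real (2 * card T)) \<le> real (2 * card T)"
  proof -
    have "real (2 * card T) < 2 ^ (2 * card T)"
      by (rule of_nat_less_two_power)
    then have "real (2 * card T) \<le> 2 powr real (2 * card T)"
      by (simp only: powr_realpow zero_less_numeral less_imp_le)
    then show ?thesis
      by (subst log_le_iff) (use T1 in simp_all)
  qed
  finally have log: "log 2 (real m) \<le> 4 * real (card T)" by simp
  have "active {} \<subseteq> {1..m}"
    by (auto simp: active_def)
  from card_mono[OF finite_atLeastAtMost this]
  have "level_potential (card (active {})) 0 \<le> level_potential m 0"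
    by (intro level_potential_mono) simp
  also have "\<dots> \<le> 12 * real (card T)"
    using log log_nat_nonneg[of m] by (simp add: level_potential_def)
  \<comment> \<open>\<open>2667 = 1296 * 2 + 6 * 12 + 3\<close>, the last 3 being the summand 2 and
    the bonus of the even step 0.\<close>
  finally have "potential initial_state \<le> 2667 * real (card T)"
    using T1 by (simp add: potential_def base_potential_def)
  then have "ennreal (potential initial_state) \<le> ennreal (2667 * real (card T))"
    by (rule ennreal_leI)
  also have "\<dots> = of_nat (2667 * card T)"
    by (simp add: ennreal_of_nat_eq_real_of_nat)
  finally show ?thesis
    using expected_time_le[OF False] by (rule order_trans[rotated])
qed

theorem theorem2:
  shows "\<exists>(A :: algorithm) (c :: nat) (d :: nat).
    \<forall>(n :: nat) (E :: edge set) (held :: nat \<Rightarrow> edge).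
      simple_graph n E \<and> bij_betw held {1..card E} E \<longrightarrow>
        (\<forall>\<omega>. \<exists>T. spanning_forest E T \<and> T \<subseteq> revealed A n (card E) held \<omega>) \<and>
        (\<forall>T. spanning_forest E T \<longrightarrow>
           expected_time A n (card E) held \<le> of_nat (c * card T)) \<and>
        (\<forall>\<omega>. running_time A n (card E) held \<omega> \<le> enat (d * card E))"
proof (intro exI allI impI)
  fix n E held
  assume "simple_graph n E \<and> bij_betw held {1..card E} E"
  then interpret held_graph n E held
    by unfold_locales auto
  show "(\<forall>\<omega>. \<exists>T. spanning_forest E T \<and> T \<subseteq> revealed forest_algorithm n (card E) held \<omega>) \<and>
      (\<forall>T. spanning_forest E T \<longrightarrow>
         expected_time forest_algorithm n (card E) held \<le> of_nat (2667 * card T)) \<and>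
      (\<forall>\<omega>. running_time forest_algorithm n (card E) held \<omega> \<le> enat (6 * card E))"
    using spanning_forest_revealed expected_time_linear running_time_le unfolding m_def by blast
qed

end
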